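(* Given a connection $\Delta^h$ on a bundle $(E,\pi,M)$, there is a unique (axiomatically defined) parallel transport $\mathsf P$ in $(E,\pi,M)$ such that the parallel transport $P$ along paths defined by $\mathsf P$ generates $\Delta^h$, $\Delta^P=\Delta^h$. Besides, $\mathsf P$ coincides with the parallel transport assigned to $\Delta^h$.
   Context: $\mathbb K=\mathbb R$ or $\mathbb C$. $(E,\pi,M)$ is a bundle with projection $\pi\colon E\to M$; $M$ and $E$ are $C^1$ manifolds over $\mathbb K$ of finite dimensions $n\ge 1$ and $n+r$, $r\ge 1$. $J$ denotes an arbitrary real interval, $[\sigma,\tau]$ a closed one. Paths are $C^1$ maps from real intervals (one-sided derivatives at closed endpoints; intervals nondegenerate wherever a tangent vector is taken); an identity involving a product path is asserted whenever the product is again such a path. The inverse of $\gamma\colon[0,1]\to M$ is $\gamma_-(t)=\gamma(1-t)$; if $\gamma_1(1)=\gamma_2(0)$, the product $\gamma_1\gamma_2\colon[0,1]\to M$ is $\gamma_1(2t)$ for $t\in[0,1/2]$ and $\gamma_2(2t-1)$ for $t\in[1/2,1]$. (Axiomatically defined) parallel transport: a map $\mathsf P$ assigning to each path $\gamma\colon[\sigma,\tau]\to M$ a map $\mathsf P^\gamma\colon\pi^{-1}(\gamma(\sigma))\to\pi^{-1}(\gamma(\tau))$ such that: (i) $\mathsf P^{\gamma\circ\chi}=\mathsf P^\gamma$ for every orientation preserving $C^1$ diffeomorphism $\chi\colon[\sigma',\tau']\to[\sigma,\tau]$; (ii) $\mathsf P^{\gamma_-}=(\mathsf P^\gamma)^{-1}$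 for $\gamma\colon[0,1]\to M$; (iii) $\mathsf P^{\gamma_1\gamma_2}=\mathsf P^{\gamma_2}\circ\mathsf P^{\gamma_1}$ for $\gamma_1,\gamma_2\colon[0,1]\to M$ with $\gamma_1(1)=\gamma_2(0)$; (iv) $\mathsf P^{\gamma_{r,x}}=\mathrm{id}_{\pi^{-1}(x)}$ for $\gamma_{r,x}\colon\{r\}=[r,r]\to\{x\}$, $r\in\mathbb R$, $x\in M$; (v) with $\bar\gamma_p(s)=\mathsf P^{\gamma|[\sigma,s]}(p)$, $s\in[\sigma,\tau]$, $p\in\pi^{-1}(\gamma(\sigma))$: $\bar\gamma_p$ is $C^1$ for every $C^1$ path $\gamma$, and if $C^1$ paths $\gamma_i\colon[\sigma_i,\tau_i]\to M$, $i=1,2$, satisfy $\gamma_1(\sigma_1)=\gamma_2(\sigma_2)$ and $\dot\gamma_1(\sigma_1)=\dot\gamma_2(\sigma_2)$, then $\dot{\bar\gamma}_{1;p}(\sigma_1)=\dot{\bar\gamma}_{2;p}(\sigma_2)$; (vi) if $\gamma_i\colon[\sigma_i,\tau_i]\to M$, $i=1,2$, are $C^1$ with $\gamma_1(\sigma_1)=\gamma_2(\sigma_2)$, then for every $a_1,a_2\in\mathbb K$ there is a $C^1$ path $\gamma_3\colon[\sigma_3,\tau_3]\to M$ with $\gamma_3(\sigma_3)=\gamma_1(\sigma_1)$ and $\dot{\bar\gamma}_{3;p}(\sigma_3)=a_1\dot{\bar\gamma}_{1;p}(\sigma_1)+a_2\dot{\bar\gamma}_{2;p}(\sigma_2)$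 for $p\in\pi^{-1}(\gamma_3(\sigma_3))$. The parallel transport $P$ along paths defined by $\mathsf P$ is the family of maps $P^\beta_{s\to t}\colon\pi^{-1}(\beta(s))\to\pi^{-1}(\beta(t))$, for paths $\beta\colon J\to M$ and $s,t\in J$, given by $P^\beta_{s\to t}=\mathsf P^{\beta|[s,t]}$ if $s\le t$ and $P^\beta_{s\to t}=(\mathsf P^{\beta|[t,s]})^{-1}$ if $s\ge t$. The connection $\Delta^P$ generated by it is $\Delta^P_p=\{\frac{d}{dt}|_{t=s_0}P^\gamma_{s_0\to t}(p):\gamma\colon J\to M\ C^1\text{ and injective},\ s_0\in J,\ \gamma(s_0)=\pi(p)\}$, $p\in E$. Connection: an $n$-dimensional distribution $\Delta^h\colon p\mapsto\Delta^h_p\subseteq T_p(E)$ on $E$ with $\Delta^v_p\oplus\Delta^h_p=T_p(E)$ for all $p\in E$, where $\Delta^v_p=T_p(\pi^{-1}(\pi(p)))$. A horizontal lift of a $C^1$ path $\gamma\colon J\to M$ is a $C^1$ path $\bar\gamma\colon J\to E$ with $\pi\circ\bar\gamma=\gamma$ and $\dot{\bar\gamma}(s)\in\Delta^h_{\bar\gamma(s)}$ for all $s$. Connections are such that for each $\gamma$, $s_0\in J$, $p\in\pi^{-1}(\gamma(s_0))$ there is a unique horizontal lift with value $p$ at $s_0$. The parallel transport assigned to $\Delta^h$ assigns to $\gamma\colon[\sigma,\tau]\to M$ the map $\pi^{-1}(\gamma(\sigma))\to\pi^{-1}(\gamma(\tau))$, $p\mapsto\bar\gamma_p(\tau)$,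 where $\bar\gamma_p$ is the horizontal lift of $\gamma$ with $\bar\gamma_p(\sigma)=p$. *)

theory Defs
  imports "HOL-Analysis.Analysis" "HOL-Library.FuncSet" "HOL-Library.Function_Algebras"
begin

(* The ground field K is a type 'k of sort {real_normed_field, euclidean_space}.  Both real and
   complex have this sort, and by the Gelfand-Mazur/Frobenius theorem every type of this sort is
   isometrically isomorphic to one of them. *)

section \<open>Manifolds of class C1 over K\<close>

(* The derivative has to be K-linear: for K = complex the maps are holomorphic. *)
definition K_C1_on ::
  "(('k::{real_normed_field,euclidean_space}, 'a::finite) vec) set
    \<Rightarrow> (('k, 'a) vec \<Rightarrow> ('k, 'b::finite) vec) \<Rightarrow> bool" where
  "K_C1_on S f \<longleftrightarrow>
     (\<exists>f' :: ('k, 'a) vec \<Rightarrow> ('k, 'a) vec \<Rightarrow>\<^sub>L ('k, 'b) vec.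
        continuous_on S f' \<and>
        (\<forall>x\<in>S. (f has_derivative blinfun_apply (f' x)) (at x) \<and>
               Vector_Spaces.linear (*s) (*s) (blinfun_apply (f' x))))"

(* A chart is its domain together with its coordinate map. *)
type_synonym ('a, 'k, 'n) chart = "'a set \<times> ('a \<Rightarrow> ('k, 'n) vec)"

definition local_rep :: "('a, 'k, 'n) chart \<Rightarrow> ('b, 'k, 'l) chart \<Rightarrow> ('a \<Rightarrow> 'b)
    \<Rightarrow> ('k, 'n) vec \<Rightarrow> ('k, 'l) vec" where
  "local_rep c c' f = snd c' \<circ> f \<circ> the_inv_into (fst c) (snd c)"

definition is_chart :: "('a::topological_space, 'k::{real_normed_field,euclidean_space}, 'n::finite) chart \<Rightarrow> bool" where
  "is_chart c \<longleftrightarrow> open (fst c) \<and> open (snd c ` fst c) \<and>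
     homeomorphism (fst c) (snd c ` fst c) (snd c) (the_inv_into (fst c) (snd c))"

(* A C^1 manifold of dimension CARD('n) over 'k whose underlying space is the type 'a.
   The atlas need not be maximal. *)
definition C1_manifold :: "('a::t2_space, 'k::{real_normed_field,euclidean_space}, 'n::finite) chart set \<Rightarrow> bool" where
  "C1_manifold A \<longleftrightarrow>
     (\<forall>c\<in>A. is_chart c) \<and> (\<Union>c\<in>A. fst c) = UNIV \<and>
     (\<forall>c\<in>A. \<forall>c'\<in>A. K_C1_on (snd c ` (fst c \<inter> fst c')) (local_rep c c' id))"

definition C1_map :: "('a::t2_space, 'k::{real_normed_field,euclidean_space}, 'n::finite) chart set
    \<Rightarrow> ('b::t2_space, 'k, 'l::finite) chart set \<Rightarrow> ('a \<Rightarrow> 'b) \<Rightarrow> bool" where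
  "C1_map A B f \<longleftrightarrow> continuous_on UNIV f \<and>
     (\<forall>c\<in>A. \<forall>c'\<in>B. K_C1_on (snd c ` (fst c \<inter> f -` fst c')) (local_rep c c' f))"

definition submersion :: "('a::t2_space, 'k::{real_normed_field,euclidean_space}, 'n::finite) chart set
    \<Rightarrow> ('b::t2_space, 'k, 'l::finite) chart set \<Rightarrow> ('a \<Rightarrow> 'b) \<Rightarrow> bool" where
  "submersion A B f \<longleftrightarrow> C1_map A B f \<and>
     (\<forall>c\<in>A. \<forall>c'\<in>B. \<forall>p\<in>fst c \<inter> f -` fst c'.
        surj (frechet_derivative (local_rep c c' f) (at (snd c p))))"


section \<open>Tangent vectors\<close>

(* A tangent vector at p is the family of its coordinate vectors in all charts around p, related
   by the differentials of the coordinate changes; entries at other charts are 0, so that the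
   vector space operations are the pointwise ones. *)
type_synonym ('a, 'k, 'n) tvec = "('a, 'k, 'n) chart \<Rightarrow> ('k, 'n) vec"

definition tscale :: "'k::field \<Rightarrow> ('a, 'k, 'n::finite) tvec \<Rightarrow> ('a, 'k, 'n) tvec" where
  "tscale a v = (\<lambda>c. a *s v c)"

interpretation tangent: vector_space tscale
  by unfold_locales
    (auto simp: tscale_def fun_eq_iff vec.scale_right_distrib vec.scale_left_distrib)

definition tangent_space :: "('a::t2_space, 'k::{real_normed_field,euclidean_space}, 'n::finite) chart set
    \<Rightarrow> 'a \<Rightarrow> ('a, 'k, 'n) tvec set" where
  "tangent_space A p =
     {v. (\<forall>c. c \<notin> A \<or> p \<notin> fst c \<longrightarrow> v c = 0) \<and>
         (\<forall>c\<in>A. \<forall>c'\<in>A. p \<in> fst c \<and> p \<in> fst c' \<longrightarrow>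
            v c' = frechet_derivative (local_rep c c' id) (at (snd c p)) (v c))}"


section \<open>Paths of class C1\<close>

(* Derivatives are taken within S, hence one-sided at end points belonging to S; the condition is
   void on a singleton. *)
definition C1_on :: "real set \<Rightarrow> (real \<Rightarrow> 'v::real_normed_vector) \<Rightarrow> bool" where
  "C1_on S f \<longleftrightarrow> (\<exists>D. (\<forall>s\<in>S. (f has_vector_derivative D s) (at s within S)) \<and> continuous_on S D)"

(* Maps with domain J are functions that are undefined off J, so that equality of paths,
   of transports etc. is equality in HOL. *)
definition C1_paths :: "('a::t2_space, 'k::{real_normed_field,euclidean_space}, 'n::finite) chart set
    \<Rightarrow> real set \<Rightarrow> (real \<Rightarrow> 'a) set" where
  "C1_paths A J =
     {\<gamma> \<in> extensional J. is_interval J \<and> J \<noteq> {} \<and> continuous_on J \<gamma> \<and>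
        (\<forall>c\<in>A. C1_on (J \<inter> \<gamma> -` fst c) (snd c \<circ> \<gamma>))}"

(* Only meaningful if s is in J and J is nondegenerate, i.e. J is not {s}. *)
definition velocity :: "('a::t2_space, 'k::{real_normed_field,euclidean_space}, 'n::finite) chart set
    \<Rightarrow> real set \<Rightarrow> (real \<Rightarrow> 'a) \<Rightarrow> real \<Rightarrow> ('a, 'k, 'n) tvec" where
  "velocity A J \<gamma> s =
     (\<lambda>c. if c \<in> A \<and> \<gamma> s \<in> fst c then vector_derivative (snd c \<circ> \<gamma>) (at s within J) else 0)"

definition orientation_preserving_C1_diffeo :: "real set \<Rightarrow> real set \<Rightarrow> (real \<Rightarrow> real) \<Rightarrow> bool" where
  "orientation_preserving_C1_diffeo I J \<theta> \<longleftrightarrow>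
     bij_betw \<theta> I J \<and> strict_mono_on I \<theta> \<and> C1_on I \<theta> \<and> C1_on J (the_inv_into I \<theta>)"

definition inverse_path :: "(real \<Rightarrow> 'a) \<Rightarrow> real \<Rightarrow> 'a" where
  "inverse_path \<gamma> = (\<lambda>t\<in>{0..1}. \<gamma> (1 - t))"

definition product_path :: "(real \<Rightarrow> 'a) \<Rightarrow> (real \<Rightarrow> 'a) \<Rightarrow> real \<Rightarrow> 'a" where
  "product_path \<gamma>1 \<gamma>2 = (\<lambda>t\<in>{0..1}. if t \<le> 1/2 then \<gamma>1 (2 * t) else \<gamma>2 (2 * t - 1))"


section \<open>Bundles and connections\<close>

(* Base of dimension CARD('n), total space of dimension CARD('n) + CARD('r).  Local triviality is
   not required; every locally trivial C^1 bundle is a surjective submersion. *)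
definition C1_bundle :: "('m::t2_space, 'k::{real_normed_field,euclidean_space}, 'n::finite) chart set
    \<Rightarrow> ('e::t2_space, 'k, 'n + 'r::finite) chart set \<Rightarrow> ('e \<Rightarrow> 'm) \<Rightarrow> bool" where
  "C1_bundle atlM atlE \<pi> \<longleftrightarrow>
     C1_manifold atlM \<and> C1_manifold atlE \<and> surj \<pi> \<and> submersion atlE atlM \<pi>"

abbreviation fibre :: "('e \<Rightarrow> 'm) \<Rightarrow> 'm \<Rightarrow> 'e set" where
  "fibre \<pi> x \<equiv> \<pi> -` {x}"

(* The tangent space of the fibre through p, as a subspace of the tangent space of E: the
   velocities at p of the C^1 paths lying in that fibre. *)
definition vertical :: "('e::t2_space, 'k::{real_normed_field,euclidean_space}, 'd::finite) chart set
    \<Rightarrow> ('e \<Rightarrow> 'm) \<Rightarrow> 'e \<Rightarrow> ('e, 'k, 'd) tvec set" where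
  "vertical atlE \<pi> p =
     {velocity atlE J \<gamma> s | J \<gamma> s. \<gamma> \<in> C1_paths atlE J \<and> s \<in> J \<and> J \<noteq> {s} \<and>
        \<gamma> ` J \<subseteq> fibre \<pi> (\<pi> p) \<and> \<gamma> s = p}"

definition horizontal_lift :: "('e::t2_space, 'k::{real_normed_field,euclidean_space}, 'd::finite) chart set
    \<Rightarrow> ('e \<Rightarrow> 'm) \<Rightarrow> ('e \<Rightarrow> ('e, 'k, 'd) tvec set) \<Rightarrow> real set
    \<Rightarrow> (real \<Rightarrow> 'm) \<Rightarrow> (real \<Rightarrow> 'e) \<Rightarrow> bool" where
  "horizontal_lift atlE \<pi> \<Delta> J \<gamma> \<delta> \<longleftrightarrow>
     \<delta> \<in> C1_paths atlE J \<and> (\<forall>s\<in>J. \<pi> (\<delta> s) = \<gamma> s) \<and>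
     (\<forall>s\<in>J. J \<noteq> {s} \<longrightarrow> velocity atlE J \<delta> s \<in> \<Delta> (\<delta> s))"

definition connection :: "('m::t2_space, 'k::{real_normed_field,euclidean_space}, 'n::finite) chart set
    \<Rightarrow> ('e::t2_space, 'k, 'n + 'r::finite) chart set \<Rightarrow> ('e \<Rightarrow> 'm)
    \<Rightarrow> ('e \<Rightarrow> ('e, 'k, 'n + 'r) tvec set) \<Rightarrow> bool" where
  "connection atlM atlE \<pi> \<Delta> \<longleftrightarrow>
     (\<forall>p. \<Delta> p \<subseteq> tangent_space atlE p \<and> tangent.subspace (\<Delta> p) \<and> tangent.dim (\<Delta> p) = CARD('n)) \<and>
     (\<forall>p. tangent_space atlE p = {v + w | v w. v \<in> vertical atlE \<pi> p \<and> w \<in> \<Delta> p} \<and>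
          vertical atlE \<pi> p \<inter> \<Delta> p = {0}) \<and>
     (\<forall>J. \<forall>\<gamma>\<in>C1_paths atlM J. \<forall>s0\<in>J. \<forall>p\<in>fibre \<pi> (\<gamma> s0).
          \<exists>!\<delta>. horizontal_lift atlE \<pi> \<Delta> J \<gamma> \<delta> \<and> \<delta> s0 = p)"


section \<open>Parallel transports\<close>

(* A transport P assigns to a path \<gamma> on the interval from \<sigma> to \<tau> the map P \<sigma> \<tau> \<gamma> between fibres. *)
type_synonym ('m, 'e) transport = "real \<Rightarrow> real \<Rightarrow> (real \<Rightarrow> 'm) \<Rightarrow> 'e \<Rightarrow> 'e"

definition transport_maps :: "('m::t2_space, 'k::{real_normed_field,euclidean_space}, 'n::finite) chart set
    \<Rightarrow> ('e \<Rightarrow> 'm) \<Rightarrow> ('m, 'e) transport \<Rightarrow> bool" where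
  "transport_maps atlM \<pi> P \<longleftrightarrow>
     (\<forall>\<sigma> \<tau> \<gamma>. if \<gamma> \<in> C1_paths atlM {\<sigma>..\<tau>}
               then P \<sigma> \<tau> \<gamma> \<in> fibre \<pi> (\<gamma> \<sigma>) \<rightarrow>\<^sub>E fibre \<pi> (\<gamma> \<tau>)
               else P \<sigma> \<tau> \<gamma> = undefined)"

definition lifted_path :: "('m, 'e) transport \<Rightarrow> real \<Rightarrow> real \<Rightarrow> (real \<Rightarrow> 'm) \<Rightarrow> 'e \<Rightarrow> real \<Rightarrow> 'e" where
  "lifted_path P \<sigma> \<tau> \<gamma> p = (\<lambda>s\<in>{\<sigma>..\<tau>}. P \<sigma> s (restrict \<gamma> {\<sigma>..s}) p)"

(* After the typing condition: invariance under reparametrisation; inverse paths; products (only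
   products that are again C^1 paths); constant paths on one-point intervals; lifted paths are C^1;
   their initial velocity depends only on that of the path; and these initial velocities are
   closed under K-linear combinations, with a path that does not depend on the point p. *)
definition parallel_transport :: "('m::t2_space, 'k::{real_normed_field,euclidean_space}, 'n::finite) chart set
    \<Rightarrow> ('e::t2_space, 'k, 'd::finite) chart set \<Rightarrow> ('e \<Rightarrow> 'm) \<Rightarrow> ('m, 'e) transport \<Rightarrow> bool" where
  "parallel_transport atlM atlE \<pi> P \<longleftrightarrow>
     transport_maps atlM \<pi> P \<and>
     (\<forall>\<sigma> \<tau> \<sigma>' \<tau>' \<theta>. \<forall>\<gamma>\<in>C1_paths atlM {\<sigma>..\<tau>}.
        orientation_preserving_C1_diffeo {\<sigma>'..\<tau>'} {\<sigma>..\<tau>} \<theta> \<longrightarrow>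
        P \<sigma>' \<tau>' (compose {\<sigma>'..\<tau>'} \<gamma> \<theta>) = P \<sigma> \<tau> \<gamma>) \<and>
     (\<forall>\<gamma>\<in>C1_paths atlM {0..1}.
        bij_betw (P 0 1 \<gamma>) (fibre \<pi> (\<gamma> 0)) (fibre \<pi> (\<gamma> 1)) \<and>
        P 0 1 (inverse_path \<gamma>) = restrict (inv_into (fibre \<pi> (\<gamma> 0)) (P 0 1 \<gamma>)) (fibre \<pi> (\<gamma> 1))) \<and>
     (\<forall>\<gamma>1\<in>C1_paths atlM {0..1}. \<forall>\<gamma>2\<in>C1_paths atlM {0..1}.
        \<gamma>1 1 = \<gamma>2 0 \<and> product_path \<gamma>1 \<gamma>2 \<in> C1_paths atlM {0..1} \<longrightarrow>
        P 0 1 (product_path \<gamma>1 \<gamma>2) = compose (fibre \<pi> (\<gamma>1 0)) (P 0 1 \<gamma>2) (P 0 1 \<gamma>1)) \<and>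
     (\<forall>r x. P r r (\<lambda>t\<in>{r..r}. x) = (\<lambda>p\<in>fibre \<pi> x. p)) \<and>
     (\<forall>\<sigma> \<tau>. \<forall>\<gamma>\<in>C1_paths atlM {\<sigma>..\<tau>}. \<forall>p\<in>fibre \<pi> (\<gamma> \<sigma>).
        lifted_path P \<sigma> \<tau> \<gamma> p \<in> C1_paths atlE {\<sigma>..\<tau>}) \<and>
     (\<forall>\<sigma>1 \<tau>1 \<sigma>2 \<tau>2. \<forall>\<gamma>1\<in>C1_paths atlM {\<sigma>1..\<tau>1}. \<forall>\<gamma>2\<in>C1_paths atlM {\<sigma>2..\<tau>2}.
        \<sigma>1 < \<tau>1 \<and> \<sigma>2 < \<tau>2 \<and> \<gamma>1 \<sigma>1 = \<gamma>2 \<sigma>2 \<and>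
        velocity atlM {\<sigma>1..\<tau>1} \<gamma>1 \<sigma>1 = velocity atlM {\<sigma>2..\<tau>2} \<gamma>2 \<sigma>2 \<longrightarrow>
        (\<forall>p\<in>fibre \<pi> (\<gamma>1 \<sigma>1).
           velocity atlE {\<sigma>1..\<tau>1} (lifted_path P \<sigma>1 \<tau>1 \<gamma>1 p) \<sigma>1 =
           velocity atlE {\<sigma>2..\<tau>2} (lifted_path P \<sigma>2 \<tau>2 \<gamma>2 p) \<sigma>2)) \<and>
     (\<forall>\<sigma>1 \<tau>1 \<sigma>2 \<tau>2. \<forall>\<gamma>1\<in>C1_paths atlM {\<sigma>1..\<tau>1}. \<forall>\<gamma>2\<in>C1_paths atlM {\<sigma>2..\<tau>2}.
        \<sigma>1 < \<tau>1 \<and> \<sigma>2 < \<tau>2 \<and> \<gamma>1 \<sigma>1 = \<gamma>2 \<sigma>2 \<longrightarrow>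
        (\<forall>a1 a2 :: 'k. \<exists>\<sigma>3 \<tau>3. \<sigma>3 < \<tau>3 \<and> (\<exists>\<gamma>3\<in>C1_paths atlM {\<sigma>3..\<tau>3}.
           \<gamma>3 \<sigma>3 = \<gamma>1 \<sigma>1 \<and>
           (\<forall>p\<in>fibre \<pi> (\<gamma>3 \<sigma>3).
              velocity atlE {\<sigma>3..\<tau>3} (lifted_path P \<sigma>3 \<tau>3 \<gamma>3 p) \<sigma>3 =
                tscale a1 (velocity atlE {\<sigma>1..\<tau>1} (lifted_path P \<sigma>1 \<tau>1 \<gamma>1 p) \<sigma>1) +
                tscale a2 (velocity atlE {\<sigma>2..\<tau>2} (lifted_path P \<sigma>2 \<tau>2 \<gamma>2 p) \<sigma>2)))))"

definition transport_along :: "('e \<Rightarrow> 'm) \<Rightarrow> ('m, 'e) transport \<Rightarrow> (real \<Rightarrow> 'm)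
    \<Rightarrow> real \<Rightarrow> real \<Rightarrow> 'e \<Rightarrow> 'e" where
  "transport_along \<pi> P \<beta> s t =
     (if s \<le> t then P s t (restrict \<beta> {s..t})
      else restrict (inv_into (fibre \<pi> (\<beta> t)) (P t s (restrict \<beta> {t..s}))) (fibre \<pi> (\<beta> s)))"

definition generated_connection :: "('m::t2_space, 'k::{real_normed_field,euclidean_space}, 'n::finite) chart set
    \<Rightarrow> ('e::t2_space, 'k, 'd::finite) chart set \<Rightarrow> ('e \<Rightarrow> 'm) \<Rightarrow> ('m, 'e) transport
    \<Rightarrow> 'e \<Rightarrow> ('e, 'k, 'd) tvec set" where
  "generated_connection atlM atlE \<pi> P p =
     {velocity atlE J (\<lambda>t\<in>J. transport_along \<pi> P \<gamma> s0 t p) s0 | J \<gamma> s0.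
        \<gamma> \<in> C1_paths atlM J \<and> inj_on \<gamma> J \<and> s0 \<in> J \<and> J \<noteq> {s0} \<and> \<gamma> s0 = \<pi> p}"

definition assigned_transport :: "('m::t2_space, 'k::{real_normed_field,euclidean_space}, 'n::finite) chart set
    \<Rightarrow> ('e::t2_space, 'k, 'd::finite) chart set \<Rightarrow> ('e \<Rightarrow> 'm) \<Rightarrow> ('e \<Rightarrow> ('e, 'k, 'd) tvec set)
    \<Rightarrow> ('m, 'e) transport" where
  "assigned_transport atlM atlE \<pi> \<Delta> \<sigma> \<tau> \<gamma> =
     (if \<gamma> \<in> C1_paths atlM {\<sigma>..\<tau>}
      then \<lambda>p\<in>fibre \<pi> (\<gamma> \<sigma>). (THE \<delta>. horizontal_lift atlE \<pi> \<Delta> {\<sigma>..\<tau>} \<gamma> \<delta> \<and> \<delta> \<sigma> = p) \<tau>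
      else undefined)"

end

theory Submission
  imports Defs
begin

text \<open>The differential of the projection restricts to an isomorphism on each horizontal space, so a
  horizontal velocity is determined by the velocity of the projected path. Together with uniqueness of
  horizontal lifts, and the fact that a lift composed with a C1 injection of intervals is again a lift,
  this yields all axioms for the assigned transport. Every tangent vector of the base, including 0, is
  the velocity of an injective path, so the assigned transport generates the whole connection.

  Conversely, let \<open>P\<close> be a parallel transport generating the connection. By the axioms on products and
  inverses, its lifted paths have at every time, up to sign, the initial velocity of some lifted path,
  and initial velocities depend only on the velocity of the base path, which may be taken injective.
  Hence the lifted paths are horizontal, and \<open>P\<close> is the assigned transport.\<close>

section \<open>Paths of class C1\<close>

text \<open>The generated connection speaks of a lifted path only at its starting time, so
  horizontality at a later time \<open>s\<close> has to be reached by a transport that starts at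
  \<open>s\<close>. Running backwards from \<open>s\<close> serves interior times and the right end
  alike. The obstacle is that the axiom on products covers only paths on the unit interval, joined
  at 1/2, whose product is again of class C1. An affine change of parameter can split a path only at
  its midpoint, and a piecewise affine one usually has a corner at 1/2. Prescribing the images of 0,
  1/2 and 1 determines a fractional linear map, which is smooth and has an inverse of the same kind;
  this is why such maps are studied before any geometry.\<close>

lemma C1_onI:
  "(\<And>s. s \<in> S \<Longrightarrow> (f has_vector_derivative D s) (at s within S)) \<Longrightarrow> continuous_on S D \<Longrightarrow> C1_on S f"
  unfolding C1_on_def by blast

lemma C1_on_subset: "C1_on S f \<Longrightarrow> T \<subseteq> S \<Longrightarrow> C1_on T f"
  unfolding C1_on_def
  using continuous_on_subset has_vector_derivative_within_subset by (metis subsetD)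

lemma C1_on_cong:
  assumes "C1_on S f" and "\<And>x. x \<in> S \<Longrightarrow> f x = g x"
  shows "C1_on S g"
proof -
  obtain D where D: "\<And>s. s \<in> S \<Longrightarrow> (f has_vector_derivative D s) (at s within S)"
    and cont: "continuous_on S D"
    using assms(1) unfolding C1_on_def by blast
  have "(g has_vector_derivative D s) (at s within S)" if "s \<in> S" for s
    by (rule has_vector_derivative_transform[OF that _ D[OF that]]) (simp add: assms(2))
  then show ?thesis
    using cont by (rule C1_onI)
qed

lemma C1_on_imp_continuous_on: "C1_on S f \<Longrightarrow> continuous_on S f"
  unfolding C1_on_def continuous_on_eq_continuous_within
  by (auto intro: has_vector_derivative_continuous)

lemma C1_on_compose:
  assumes f: "C1_on S f" and \<theta>: "C1_on T \<theta>" and sub: "\<theta> ` T \<subseteq> S"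
  shows "C1_on T (f \<circ> \<theta>)"
proof -
  obtain D where D: "\<And>s. s \<in> S \<Longrightarrow> (f has_vector_derivative D s) (at s within S)"
    and contD: "continuous_on S D"
    using f unfolding C1_on_def by blast
  obtain E where E: "\<And>s. s \<in> T \<Longrightarrow> (\<theta> has_vector_derivative E s) (at s within T)"
    and contE: "continuous_on T E"
    using \<theta> unfolding C1_on_def by blast
  have "((f \<circ> \<theta>) has_vector_derivative E s *\<^sub>R D (\<theta> s)) (at s within T)" if "s \<in> T" for s
  proof (rule vector_diff_chain_within[OF E[OF that]])
    show "(f has_vector_derivative D (\<theta> s)) (at (\<theta> s) within \<theta> ` T)"
      using D sub that by (meson has_vector_derivative_within_subset image_subset_iff)
  qed
  moreover have "continuous_on T (\<lambda>s. E s *\<^sub>R D (\<theta> s))"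
    using contE continuous_on_compose2[OF contD C1_on_imp_continuous_on[OF \<theta>] sub]
    by (intro continuous_intros)
  ultimately show ?thesis
    by (rule C1_onI)
qed

lemma C1_on_ident: "C1_on S (\<lambda>x. x)"
  by (rule C1_onI[where D = "\<lambda>_. 1"]) (auto intro: derivative_eq_intros)

section \<open>Fractional linear maps of intervals\<close>

lemma C1_on_moebius:
  fixes a b c d :: real
  assumes "\<And>x. x \<in> S \<Longrightarrow> c * x + d \<noteq> 0"
  shows "C1_on S (\<lambda>x. (a * x + b) / (c * x + d))"
proof -
  have "((\<lambda>x. (a * x + b) / (c * x + d)) has_vector_derivative
      (a * d - b * c) / ((c * s + d) * (c * s + d))) (at s within S)" if "s \<in> S" for s
    unfolding has_real_derivative_iff_has_vector_derivative[symmetric]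
    by (rule derivative_eq_intros refl assms that)+ (simp add: algebra_simps)
  moreover have "continuous_on S (\<lambda>s. (a * d - b * c) / ((c * s + d) * (c * s + d)))"
    using assms by (intro continuous_intros) auto
  ultimately show ?thesis
    by (rule C1_onI)
qed

lemma C1_on_affine: "C1_on S (\<lambda>x :: real. a * x + b)"
  using C1_on_moebius[of S 0 1 a b] by simp

text \<open>A difference of two values is the determinant times the difference of the arguments,
  divided by a product of denominators, so a positive determinant gives strict growth. The
  denominator is affine, hence positive on the interval as soon as it is so at both ends. The
  inverse is fractional linear as well, hence C1.\<close>

lemma moebius_diffeo:
  fixes a b c d :: real
  defines "m \<equiv> \<lambda>x. (a * x + b) / (c * x + d)"
  assumes det: "a * d - b * c > 0" and l: "c * l + d > 0" and u: "c * u + d > 0"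
  shows "orientation_preserving_C1_diffeo {l..u} {m l..m u} m"
proof -
  have pos: "c * x + d > 0" if "x \<in> {l..u}" for x
  proof (cases "c \<ge> 0")
    case True
    then have "c * x \<ge> c * l" using that by (simp add: mult_left_mono)
    then show ?thesis using l by simp
  next
    case False
    then have "c * x \<ge> c * u" using that by (simp add: mult_left_mono_neg)
    then show ?thesis using u by simp
  qed
  have diff: "m y - m x = (a * d - b * c) * (y - x) / ((c * x + d) * (c * y + d))"
    if "x \<in> {l..u}" "y \<in> {l..u}" for x y
    using pos[OF that(1)] pos[OF that(2)] unfolding m_def
    by (simp add: divide_simps) (simp add: algebra_simps)
  have smono: "strict_mono_on {l..u} m"
  proof (rule strict_mono_onI)
    fix x y assume xy: "x \<in> {l..u}" "y \<in> {l..u}" "x < y"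
    have "(a * d - b * c) * (y - x) / ((c * x + d) * (c * y + d)) > 0"
      using xy det pos[OF xy(1)] pos[OF xy(2)] by simp
    then show "m x < m y"
      using diff[OF xy(1,2)] by simp
  qed
  have contm: "continuous_on {l..u} m"
    unfolding m_def using pos by (intro continuous_intros) force
  have inj: "inj_on m {l..u}"
    using smono by (rule strict_mono_on_imp_inj_on)
  have img: "m ` {l..u} = {m l..m u}"
  proof (cases "l \<le> u")
    case True
    show ?thesis
    proof
      show "m ` {l..u} \<subseteq> {m l..m u}"
        using strict_mono_on_leD[OF smono] True by auto
      show "{m l..m u} \<subseteq> m ` {l..u}"
      proof
        fix y assume "y \<in> {m l..m u}"
        then obtain x where "x \<in> {l..u}" "m x = y"
          using IVT'[of m l y u] True contm by auto
        then show "y \<in> m ` {l..u}" by blast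
      qed
    qed
  next
    case False
    \<comment> \<open>For \<open>u < l\<close> the source interval is empty, and the order of the
      end values makes the target interval empty too.\<close>
    have "m u - m l < 0"
    proof -
      have "m u - m l = (a * d - b * c) * (u - l) / ((c * l + d) * (c * u + d))"
        using l u unfolding m_def by (simp add: divide_simps) (simp add: algebra_simps)
      then show ?thesis
        using False det l u by (simp add: divide_less_0_iff mult_less_0_iff)
    qed
    then show ?thesis using False by simp
  qed
  have bij: "bij_betw m {l..u} {m l..m u}"
    using inj img by (simp add: bij_betw_def)
  \<comment> \<open>Numerator and denominator of the candidate inverse at \<open>m x\<close> share
    the factor determinant over \<open>c * x + d\<close>. It is positive, so the denominator does
    not vanish and the quotient is \<open>x\<close>.\<close>
  have den: "- c * m x + a = (a * d - b * c) / (c * x + d)"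
    and num: "d * m x + - b = x * ((a * d - b * c) / (c * x + d))" if "x \<in> {l..u}" for x
    using pos[OF that] unfolding m_def by (auto simp: field_simps)
  have den0: "- c * m x + a \<noteq> 0" if "x \<in> {l..u}" for x
    using den[OF that] det pos[OF that] by simp
  have inv: "(d * m x + - b) / (- c * m x + a) = x" if "x \<in> {l..u}" for x
    unfolding den[OF that] num[OF that] using det pos[OF that] by simp
  have "C1_on {m l..m u} (\<lambda>y. (d * y + - b) / (- c * y + a))"
    by (rule C1_on_moebius) (use den0 img in \<open>force\<close>)
  then have "C1_on {m l..m u} (the_inv_into {l..u} m)"
  proof (rule C1_on_cong)
    fix y assume "y \<in> {m l..m u}"
    then obtain x where "x \<in> {l..u}" "y = m x"
      using img by blast
    then show "(d * y + - b) / (- c * y + a) = the_inv_into {l..u} m y"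
      using inv inj by (simp add: the_inv_into_f_f)
  qed
  moreover have "C1_on {l..u} m"
    unfolding m_def by (rule C1_on_moebius) (use pos in force)
  ultimately show ?thesis
    using bij smono by (simp add: orientation_preserving_C1_diffeo_def)
qed

lemma affine_diffeo:
  fixes a b :: real
  assumes "a > 0"
  shows "orientation_preserving_C1_diffeo {l..u} {a * l + b..a * u + b} (\<lambda>x. a * x + b)"
  using moebius_diffeo[of a 1 b 0 l u] assms by simp

lemma orientation_preserving_C1_diffeo_endpoints:
  assumes "orientation_preserving_C1_diffeo {\<sigma>'..\<tau>'} {\<sigma>..\<tau>} \<theta>" and "\<sigma> \<le> \<tau>"
  shows "\<sigma>' \<le> \<tau>'" "\<theta> \<sigma>' = \<sigma>" "\<theta> \<tau>' = \<tau>" "\<theta> ` {\<sigma>'..\<tau>'} = {\<sigma>..\<tau>}"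
proof -
  have smono: "strict_mono_on {\<sigma>'..\<tau>'} \<theta>" and img: "\<theta> ` {\<sigma>'..\<tau>'} = {\<sigma>..\<tau>}"
    using assms(1) by (auto simp: orientation_preserving_C1_diffeo_def bij_betw_def)
  show le: "\<sigma>' \<le> \<tau>'"
    using img assms(2) by (metis atLeastatMost_empty_iff image_is_empty)
  show "\<theta> ` {\<sigma>'..\<tau>'} = {\<sigma>..\<tau>}" by (rule img)
  have bounds: "\<theta> \<sigma>' \<le> \<theta> x" "\<theta> x \<le> \<theta> \<tau>'" if "x \<in> {\<sigma>'..\<tau>'}" for x
    using strict_mono_on_leD[OF smono] that le by auto
  have "\<sigma> \<in> \<theta> ` {\<sigma>'..\<tau>'}" "\<tau> \<in> \<theta> ` {\<sigma>'..\<tau>'}"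
    unfolding img using assms(2) by auto
  then obtain x y where x: "x \<in> {\<sigma>'..\<tau>'}" "\<theta> x = \<sigma>" and y: "y \<in> {\<sigma>'..\<tau>'}" "\<theta> y = \<tau>"
    by blast
  have "\<theta> \<sigma>' \<in> \<theta> ` {\<sigma>'..\<tau>'}" "\<theta> \<tau>' \<in> \<theta> ` {\<sigma>'..\<tau>'}"
    using le by auto
  then have "\<sigma> \<le> \<theta> \<sigma>'" "\<theta> \<tau>' \<le> \<tau>"
    unfolding img by auto
  then show "\<theta> \<sigma>' = \<sigma>" "\<theta> \<tau>' = \<tau>"
    using bounds(1)[OF x(1)] bounds(2)[OF y(1)] x(2) y(2) by linarith+
qed

section \<open>Paths in a manifold and their velocities\<close>

lemma C1_pathsD:
  assumes "\<gamma> \<in> C1_paths A J"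
  shows "\<gamma> \<in> extensional J" "is_interval J" "J \<noteq> {}" "continuous_on J \<gamma>"
    "c \<in> A \<Longrightarrow> C1_on (J \<inter> \<gamma> -` fst c) (snd c \<circ> \<gamma>)"
  using assms by (auto simp: C1_paths_def)

lemma C1_paths_singleton:
  fixes A :: "('a::t2_space, 'k::{real_normed_field,euclidean_space}, 'n::finite) chart set"
  shows "(\<lambda>t\<in>{r}. x) \<in> C1_paths A {r}"
proof -
  \<comment> \<open>At an isolated point the filter is trivial, so every vector, in particular 0, is
    a derivative there.\<close>
  have bot: "at r within {r} = bot"
    by (simp add: at_within_def)
  have "C1_on {r} f" for f :: "real \<Rightarrow> ('k, 'n) vec"
    by (rule C1_onI[where D = "\<lambda>_. 0"])
      (auto simp: bot has_vector_derivative_def has_derivative_def bounded_linear_zero)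
  then have "C1_on ({r} \<inter> (\<lambda>t\<in>{r}. x) -` fst c) (snd c \<circ> (\<lambda>t\<in>{r}. x))" for c :: "('a, 'k, 'n) chart"
    by (rule C1_on_subset) blast
  then show ?thesis
    by (auto simp: C1_paths_def is_interval_def eucl_le[symmetric])
qed

text \<open>Here \<open>\<theta>\<close> may be any C1 map into \<open>J\<close>, monotone or not,
  so that restriction, reversal, halving and reparametrisation of paths are all instances.\<close>

lemma C1_paths_compose:
  assumes \<gamma>: "\<gamma> \<in> C1_paths A J" and J': "is_interval J'" "J' \<noteq> {}"
    and \<theta>: "C1_on J' \<theta>" "\<theta> ` J' \<subseteq> J"
  shows "compose J' \<gamma> \<theta> \<in> C1_paths A J'"
proof -
  have "continuous_on J' (\<lambda>x. \<gamma> (\<theta> x))"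
    using continuous_on_compose2[OF C1_pathsD(4)[OF \<gamma>] C1_on_imp_continuous_on[OF \<theta>(1)] \<theta>(2)] .
  then have "continuous_on J' (compose J' \<gamma> \<theta>)"
    by (rule continuous_on_eq) (simp add: compose_def)
  moreover have "C1_on (J' \<inter> compose J' \<gamma> \<theta> -` fst c) (snd c \<circ> compose J' \<gamma> \<theta>)" if "c \<in> A" for c
  proof (rule C1_on_cong)
    show "C1_on (J' \<inter> compose J' \<gamma> \<theta> -` fst c) ((snd c \<circ> \<gamma>) \<circ> \<theta>)"
    proof (rule C1_on_compose[OF C1_pathsD(5)[OF \<gamma> that]])
      show "C1_on (J' \<inter> compose J' \<gamma> \<theta> -` fst c) \<theta>"
        by (rule C1_on_subset[OF \<theta>(1)]) auto
      show "\<theta> ` (J' \<inter> compose J' \<gamma> \<theta> -` fst c) \<subseteq> J \<inter> \<gamma> -` fst c"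
        using \<theta>(2) by (auto simp: compose_def)
    qed
  qed (auto simp: compose_def)
  ultimately show ?thesis
    using J' by (auto simp: C1_paths_def)
qed

lemma C1_paths_restrict:
  assumes "\<gamma> \<in> C1_paths A J" "is_interval J'" "J' \<noteq> {}" "J' \<subseteq> J"
  shows "restrict \<gamma> J' \<in> C1_paths A J'"
  using C1_paths_compose[OF assms(1-3) C1_on_ident] assms(4) by (simp add: compose_def)

text \<open>Membership in \<open>C1_paths\<close> gives derivatives within the part of
  \<open>J\<close> that is mapped into the chart domain, whereas \<open>velocity\<close>
  differentiates within \<open>J\<close>. That part is relatively open in \<open>J\<close> by
  continuity, so the two filters agree.\<close>

lemma at_within_chart:
  assumes A: "C1_manifold A" and \<gamma>: "\<gamma> \<in> C1_paths A J" and c: "c \<in> A" and s: "s \<in> J" "\<gamma> s \<in> fst c"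
  shows "at s within J = at s within (J \<inter> \<gamma> -` fst c)"
proof -
  have "open (fst c)"
    using A c by (auto simp: C1_manifold_def is_chart_def)
  then obtain W where W: "open W" "W \<inter> J = \<gamma> -` fst c \<inter> J"
    using C1_pathsD(4)[OF \<gamma>] continuous_on_open_invariant by metis
  show ?thesis
    by (rule at_within_nhd[of s W]) (use W s in auto)
qed

lemma has_velocity:
  assumes A: "C1_manifold A" and \<gamma>: "\<gamma> \<in> C1_paths A J" and c: "c \<in> A" and s: "s \<in> J" "\<gamma> s \<in> fst c"
  shows "((snd c \<circ> \<gamma>) has_vector_derivative velocity A J \<gamma> s c) (at s within J)"
proof -
  obtain D where "((snd c \<circ> \<gamma>) has_vector_derivative D) (at s within J)"
    using C1_pathsD(5)[OF \<gamma> c] s unfolding C1_on_def at_within_chart[OF assms] by blast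
  then have "(snd c \<circ> \<gamma>) differentiable (at s within J)"
    by (rule differentiableI_vector)
  then show ?thesis
    using c s by (simp add: velocity_def vector_derivative_works)
qed

lemma velocity_eqI:
  assumes "is_interval J" "s \<in> J" "J \<noteq> {s}" "c \<in> A" "\<gamma> s \<in> fst c"
    and "((snd c \<circ> \<gamma>) has_vector_derivative v) (at s within J)"
  shows "velocity A J \<gamma> s c = v"
proof -
  \<comment> \<open>A nondegenerate interval has no isolated points, which makes the derivative
    within it unique.\<close>
  have "s islimpt J"
    using assms(1-3) by (intro connected_imp_perfect) (auto simp: is_interval_connected)
  then have "at s within J \<noteq> bot"
    using trivial_limit_within by blast
  then show ?thesis
    using assms(4-6) by (simp add: velocity_def vector_derivative_within)
qed

lemma velocity_outside: "c \<notin> A \<or> \<gamma> s \<notin> fst c \<Longrightarrow> velocity A J \<gamma> s c = 0"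
  by (auto simp: velocity_def)

lemma scaleR_vec_conv: "r *\<^sub>R (v :: ('k::real_normed_field, 'n::finite) vec) = of_real r *s v"
  unfolding vec_eq_iff vector_scaleR_component vector_smult_component scaleR_conv_of_real[where 'a = 'k] by simp

text \<open>The chain rule in each chart. The real factor is moved into the ground field by
  \<open>of_real\<close>, because tangent vectors are scaled by \<open>tscale\<close>.\<close>

lemma velocity_compose:
  fixes A :: "('a::t2_space, 'k::{real_normed_field,euclidean_space}, 'n::finite) chart set"
  assumes A: "C1_manifold A" and \<gamma>: "\<gamma> \<in> C1_paths A J" and J': "is_interval J'" "s \<in> J'" "J' \<noteq> {s}"
    and \<theta>: "(\<theta> has_vector_derivative d) (at s within J')" "\<theta> ` J' \<subseteq> J"
  shows "velocity A J' (compose J' \<gamma> \<theta>) s = tscale (of_real d) (velocity A J \<gamma> (\<theta> s))"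
proof
  fix c
  have s: "compose J' \<gamma> \<theta> s = \<gamma> (\<theta> s)" "\<theta> s \<in> J"
    using J' \<theta> by (auto simp: compose_def)
  show "velocity A J' (compose J' \<gamma> \<theta>) s c = tscale (of_real d) (velocity A J \<gamma> (\<theta> s)) c"
  proof (cases "c \<in> A \<and> \<gamma> (\<theta> s) \<in> fst c")
    case True
    have "((snd c \<circ> \<gamma>) has_vector_derivative velocity A J \<gamma> (\<theta> s) c) (at (\<theta> s) within \<theta> ` J')"
      using has_velocity[OF A \<gamma>] True s(2) \<theta>(2) has_vector_derivative_within_subset by blast
    from vector_diff_chain_within[OF \<theta>(1) this]
    have "((snd c \<circ> compose J' \<gamma> \<theta>) has_vector_derivative d *\<^sub>R velocity A J \<gamma> (\<theta> s) c) (at s within J')"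
      by (rule has_vector_derivative_transform[OF J'(2), rotated]) (simp add: compose_def)
    then show ?thesis
      using velocity_eqI[OF J'] True s(1) by (metis scaleR_vec_conv tscale_def)
  next
    case False
    then show ?thesis
      using s(1) by (auto simp: velocity_outside tscale_def)
  qed
qed

section \<open>Charts and differentials\<close>

lemma is_chartD:
  assumes "is_chart c"
  shows "open (fst c)" "open (snd c ` fst c)" "continuous_on (fst c) (snd c)"
    "continuous_on (snd c ` fst c) (the_inv_into (fst c) (snd c))" "inj_on (snd c) (fst c)"
    "x \<in> fst c \<Longrightarrow> the_inv_into (fst c) (snd c) (snd c x) = x"
proof -
  have h: "homeomorphism (fst c) (snd c ` fst c) (snd c) (the_inv_into (fst c) (snd c))"
    using assms by (simp add: is_chart_def)
  show "open (fst c)" "open (snd c ` fst c)"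
    using assms by (auto simp: is_chart_def)
  show "continuous_on (fst c) (snd c)" "continuous_on (snd c ` fst c) (the_inv_into (fst c) (snd c))"
    "x \<in> fst c \<Longrightarrow> the_inv_into (fst c) (snd c) (snd c x) = x"
    using h by (auto simp: homeomorphism_def)
  show "inj_on (snd c) (fst c)"
    using h unfolding homeomorphism_def by (metis inj_on_inverseI)
qed

lemma C1_manifold_chart: "C1_manifold A \<Longrightarrow> c \<in> A \<Longrightarrow> is_chart c"
  by (simp add: C1_manifold_def)

lemma C1_manifold_cover:
  assumes "C1_manifold A"
  obtains c where "c \<in> A" "p \<in> fst c"
  using assms unfolding C1_manifold_def by blast

lemma C1_map_id: "C1_manifold A \<Longrightarrow> C1_map A A id"
  by (simp add: C1_manifold_def C1_map_def)

lemma local_rep_chart: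
  "is_chart c \<Longrightarrow> x \<in> fst c \<Longrightarrow> local_rep c c' f (snd c x) = snd c' (f x)"
  by (simp add: local_rep_def is_chartD(6))

lemma local_rep_derivative:
  fixes f :: "'a::t2_space \<Rightarrow> 'b::t2_space"
    and A :: "('a, 'k::{real_normed_field,euclidean_space}, 'n::finite) chart set"
  assumes "C1_map A B f" "c \<in> A" "c' \<in> B" "p \<in> fst c" "f p \<in> fst c'"
  defines "D \<equiv> frechet_derivative (local_rep c c' f) (at (snd c p))"
  shows "(local_rep c c' f has_derivative D) (at (snd c p))" "Vector_Spaces.linear (*s) (*s) D"
proof -
  have "K_C1_on (snd c ` (fst c \<inter> f -` fst c')) (local_rep c c' f)"
    using assms(1-3) by (simp add: C1_map_def)
  moreover have "snd c p \<in> snd c ` (fst c \<inter> f -` fst c')"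
    using assms(4,5) by blast
  ultimately obtain F where F: "(local_rep c c' f has_derivative blinfun_apply F) (at (snd c p))"
      "Vector_Spaces.linear (*s) (*s) (blinfun_apply F)"
    unfolding K_C1_on_def by blast
  then have "D = blinfun_apply F"
    unfolding D_def by (metis frechet_derivative_at)
  then show "(local_rep c c' f has_derivative D) (at (snd c p))" "Vector_Spaces.linear (*s) (*s) D"
    using F by auto
qed

text \<open>The conclusion is about the bare function \<open>f \<circ> \<gamma>\<close>, not about a
  member of \<open>C1_paths\<close>. With the identity for \<open>f\<close> it yields the
  transformation law of velocities under coordinate changes, with \<open>\<pi>\<close> the velocity
  of a projected path.\<close>

lemma path_image_derivative:
  fixes A :: "('a::t2_space, 'k::{real_normed_field,euclidean_space}, 'n::finite) chart set"
    and B :: "('b::t2_space, 'k, 'l::finite) chart set"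
  assumes A: "C1_manifold A" and f: "C1_map A B f" and \<gamma>: "\<gamma> \<in> C1_paths A J" and s: "s \<in> J"
    and c: "c \<in> A" "c' \<in> B" "\<gamma> s \<in> fst c" "f (\<gamma> s) \<in> fst c'"
  shows "((snd c' \<circ> (f \<circ> \<gamma>)) has_vector_derivative
      frechet_derivative (local_rep c c' f) (at (snd c (\<gamma> s))) (velocity A J \<gamma> s c)) (at s within J)"
proof -
  let ?D = "frechet_derivative (local_rep c c' f) (at (snd c (\<gamma> s)))" and ?v = "velocity A J \<gamma> s c"
  let ?S = "J \<inter> \<gamma> -` fst c"
  have at: "at s within J = at s within ?S"
    by (rule at_within_chart[OF A \<gamma> c(1) s c(3)])
  have "((snd c \<circ> \<gamma>) has_derivative (\<lambda>x. x *\<^sub>R ?v)) (at s within ?S)"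
    using has_velocity[OF A \<gamma> c(1) s c(3)] by (simp add: has_vector_derivative_def at)
  moreover have D: "(local_rep c c' f has_derivative ?D) (at (snd c (\<gamma> s)))"
    by (rule local_rep_derivative(1)[OF f c])
  ultimately have "((local_rep c c' f \<circ> (snd c \<circ> \<gamma>)) has_derivative (?D \<circ> (\<lambda>x. x *\<^sub>R ?v))) (at s within ?S)"
    by (intro diff_chain_within) (auto intro: has_derivative_at_withinI)
  moreover have "?D \<circ> (\<lambda>x. x *\<^sub>R ?v) = (\<lambda>x. x *\<^sub>R ?D ?v)"
    using has_derivative_bounded_linear[OF D] by (auto simp: linear_simps)
  ultimately have "((local_rep c c' f \<circ> (snd c \<circ> \<gamma>)) has_vector_derivative ?D ?v) (at s within ?S)"
    by (simp add: has_vector_derivative_def)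
  then have "((snd c' \<circ> (f \<circ> \<gamma>)) has_vector_derivative ?D ?v) (at s within ?S)"
    by (rule has_vector_derivative_transform[rotated 2])
      (use s c local_rep_chart[OF C1_manifold_chart[OF A c(1)], of _ c' f] in auto)
  then show ?thesis by (simp add: at)
qed

lemma velocity_in_tangent_space:
  assumes A: "C1_manifold A" and \<gamma>: "\<gamma> \<in> C1_paths A J" and s: "s \<in> J" "J \<noteq> {s}"
  shows "velocity A J \<gamma> s \<in> tangent_space A (\<gamma> s)"
proof -
  have "velocity A J \<gamma> s c' = frechet_derivative (local_rep c c' id) (at (snd c (\<gamma> s))) (velocity A J \<gamma> s c)"
    if "c \<in> A" "c' \<in> A" "\<gamma> s \<in> fst c" "\<gamma> s \<in> fst c'" for c c'
    using path_image_derivative[OF A C1_map_id[OF A] \<gamma> s(1) that(1-3)] that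
      velocity_eqI[where \<gamma> = \<gamma>, OF C1_pathsD(2)[OF \<gamma>] s that(2,4)] by simp
  moreover have "velocity A J \<gamma> s c = 0" if "c \<notin> A \<or> \<gamma> s \<notin> fst c" for c
    using that by (rule velocity_outside)
  ultimately show ?thesis
    unfolding tangent_space_def by blast
qed

text \<open>The entry at one chart around \<open>p\<close> fixes those at all other charts around
  \<open>p\<close> through the coordinate changes, and the remaining entries are 0.\<close>

lemma tangent_space_eqI:
  assumes "v \<in> tangent_space A p" "w \<in> tangent_space A p" "c \<in> A" "p \<in> fst c" "v c = w c"
  shows "v = w"
proof
  fix c'
  show "v c' = w c'"
  proof (cases "c' \<in> A \<and> p \<in> fst c'")
    case True
    then have "v c' = frechet_derivative (local_rep c c' id) (at (snd c p)) (v c)"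
      "w c' = frechet_derivative (local_rep c c' id) (at (snd c p)) (w c)"
      using assms(1-4) unfolding tangent_space_def by blast+
    then show ?thesis
      by (simp add: assms(5))
  next
    case False
    then have "v c' = 0" "w c' = 0"
      using assms(1,2) unfolding tangent_space_def by blast+
    then show ?thesis by simp
  qed
qed

text \<open>A curve \<open>h\<close> in coordinates is pulled back by the chart \<open>c\<close>; in
  any other chart it is \<open>h\<close> followed by a coordinate change, hence C1. Starting at 0 on
  a one-sided interval is enough, since only initial velocities have to be prescribed.\<close>

lemma chart_curve:
  fixes A :: "('a::t2_space, 'k::{real_normed_field,euclidean_space}, 'n::finite) chart set"
  assumes A: "C1_manifold A" and c: "c \<in> A" "x \<in> fst c" and h0: "h 0 = snd c x"
    and h: "\<And>t. (h has_vector_derivative h' t) (at t)" and h': "continuous_on UNIV h'"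
  obtains \<epsilon> \<beta> where "\<epsilon> > 0" "\<beta> \<in> C1_paths A {0..\<epsilon>}" "\<beta> 0 = x"
    "\<And>t. t \<in> {0..\<epsilon>} \<Longrightarrow> \<beta> t \<in> fst c \<and> snd c (\<beta> t) = h t" "velocity A {0..\<epsilon>} \<beta> 0 c = h' 0"
proof -
  let ?inv = "the_inv_into (fst c) (snd c)"
  note chart = is_chartD[OF C1_manifold_chart[OF A c(1)]]
  have conth: "continuous_on UNIV h"
    using h has_vector_derivative_continuous continuous_on_eq_continuous_within by metis
  have "open (h -` (snd c ` fst c))"
    using conth chart(2) by (simp add: open_vimage)
  moreover have "0 \<in> h -` (snd c ` fst c)"
    using h0 c by simp
  \<comment> \<open>The time is cut short so that \<open>h\<close> stays in the open image of the
    chart.\<close>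
  ultimately obtain \<epsilon> where \<epsilon>: "\<epsilon> > 0" and ball: "cball 0 \<epsilon> \<subseteq> h -` (snd c ` fst c)"
    using open_contains_cball_eq by blast
  have hin: "h t \<in> snd c ` fst c" if "t \<in> {0..\<epsilon>}" for t
  proof -
    have "t \<in> cball 0 \<epsilon>"
      using that by (auto simp: dist_real_def)
    then show ?thesis using ball by blast
  qed
  define \<beta> where "\<beta> = (\<lambda>t\<in>{0..\<epsilon>}. ?inv (h t))"
  have \<beta>: "\<beta> t \<in> fst c" "snd c (\<beta> t) = h t" if t: "t \<in> {0..\<epsilon>}" for t
    using hin[OF t] chart(6) t by (auto simp: \<beta>_def)
  have \<beta>0: "\<beta> 0 = x"
    using \<epsilon> h0 chart(6) c by (simp add: \<beta>_def)
  have "continuous_on {0..\<epsilon>} (\<lambda>t. ?inv (h t))"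
    by (rule continuous_on_compose2[OF chart(4) continuous_on_subset[OF conth]]) (use hin in auto)
  then have cont: "continuous_on {0..\<epsilon>} \<beta>"
    by (rule continuous_on_eq) (simp add: \<beta>_def)
  have "C1_on ({0..\<epsilon>} \<inter> \<beta> -` fst c') (snd c' \<circ> \<beta>)" if c': "c' \<in> A" for c'
  proof -
    let ?S = "{0..\<epsilon>} \<inter> \<beta> -` fst c'"
    have "K_C1_on (snd c ` (fst c \<inter> fst c')) (local_rep c c' id)"
      using A c(1) c' by (simp add: C1_manifold_def)
    then obtain F :: "('k, 'n) vec \<Rightarrow> ('k, 'n) vec \<Rightarrow>\<^sub>L ('k, 'n) vec"
      where contF: "continuous_on (snd c ` (fst c \<inter> fst c')) F"
      and F: "\<And>y. y \<in> snd c ` (fst c \<inter> fst c') \<Longrightarrow>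
        (local_rep c c' id has_derivative blinfun_apply (F y)) (at y)"
      unfolding K_C1_on_def by blast
    have hS: "h t \<in> snd c ` (fst c \<inter> fst c')" if "t \<in> ?S" for t
      using \<beta>[of t] that by (metis IntD1 IntD2 IntI image_eqI vimageE)
    have "((snd c' \<circ> \<beta>) has_vector_derivative blinfun_apply (F (h t)) (h' t)) (at t within ?S)"
      if t: "t \<in> ?S" for t
    proof -
      have "((local_rep c c' id \<circ> h) has_derivative (blinfun_apply (F (h t)) \<circ> (\<lambda>x. x *\<^sub>R h' t))) (at t within ?S)"
        using h[of t] F[OF hS[OF t]]
        by (intro diff_chain_within) (auto simp: has_vector_derivative_def intro: has_derivative_at_withinI)
      then have "((local_rep c c' id \<circ> h) has_vector_derivative blinfun_apply (F (h t)) (h' t)) (at t within ?S)"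
        by (simp add: has_vector_derivative_def o_def blinfun.scaleR_right)
      moreover have "(local_rep c c' id \<circ> h) u = (snd c' \<circ> \<beta>) u" if "u \<in> ?S" for u
        using that by (simp add: local_rep_def \<beta>_def)
      ultimately show ?thesis
        using has_vector_derivative_transform[OF t] by metis
    qed
    moreover have "continuous_on ?S (\<lambda>t. F (h t))"
      by (rule continuous_on_compose2[OF contF continuous_on_subset[OF conth]]) (use hS in auto)
    then have "continuous_on ?S (\<lambda>t. blinfun_apply (F (h t)) (h' t))"
      using continuous_on_subset[OF h'] by (intro continuous_intros) auto
    ultimately show ?thesis
      by (rule C1_onI)
  qed
  then have path: "\<beta> \<in> C1_paths A {0..\<epsilon>}"
    using \<epsilon> cont by (auto simp: C1_paths_def \<beta>_def is_interval_cc)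
  have "((snd c \<circ> \<beta>) has_vector_derivative h' 0) (at 0 within {0..\<epsilon>})"
    by (rule has_vector_derivative_transform[of _ _ _ h])
      (use \<epsilon> \<beta> in \<open>auto intro: has_vector_derivative_at_within[OF h]\<close>)
  then have "velocity A {0..\<epsilon>} \<beta> 0 c = h' 0"
    by (intro velocity_eqI) (use \<epsilon> \<beta>0 c in \<open>auto simp: is_interval_cc\<close>)
  then show ?thesis
    using that[OF \<epsilon> path \<beta>0] \<beta> by blast
qed

lemma injective_curve:
  fixes A :: "('a::t2_space, 'k::{real_normed_field,euclidean_space}, 'n::finite) chart set"
  assumes A: "C1_manifold A" and c: "c \<in> A" "x \<in> fst c"
  obtains \<epsilon> \<beta> where "\<epsilon> > 0" "\<beta> \<in> C1_paths A {0..\<epsilon>}" "\<beta> 0 = x" "inj_on \<beta> {0..\<epsilon>}"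
    "velocity A {0..\<epsilon>} \<beta> 0 c = u"
proof -
  \<comment> \<open>The quadratic term makes the curve injective when \<open>u = 0\<close>.\<close>
  define e :: "('k, 'n) vec" where "e = (if u = 0 then vec 1 else 0)"
  define h where "h = (\<lambda>t. snd c x + t *\<^sub>R u + t\<^sup>2 *\<^sub>R e)"
  have "(h has_vector_derivative u + (2 * t) *\<^sub>R e) (at t)" for t
    unfolding h_def by (auto intro!: derivative_eq_intros)
  moreover have "continuous_on UNIV (\<lambda>t. u + (2 * t) *\<^sub>R e)"
    by (intro continuous_intros)
  moreover have "h 0 = snd c x"
    by (simp add: h_def)
  ultimately obtain \<epsilon> \<beta> where b: "\<epsilon> > 0" "\<beta> \<in> C1_paths A {0..\<epsilon>}" "\<beta> 0 = x"
    "\<And>t. t \<in> {0..\<epsilon>} \<Longrightarrow> \<beta> t \<in> fst c \<and> snd c (\<beta> t) = h t" "velocity A {0..\<epsilon>} \<beta> 0 c = u + (2 * 0) *\<^sub>R e"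
    using chart_curve[OF A c, of h "\<lambda>t. u + (2 * t) *\<^sub>R e"] by blast
  have "inj_on \<beta> {0..\<epsilon>}"
  proof (rule inj_onI)
    fix s t assume st: "s \<in> {0..\<epsilon>}" "t \<in> {0..\<epsilon>}" "\<beta> s = \<beta> t"
    then have "h s = h t"
      using b(4) by metis
    \<comment> \<open>For \<open>u = 0\<close> the curve is
      \<open>snd c x + t\<^sup>2 *\<^sub>R e\<close>, and squaring is injective on nonnegative
      times; otherwise \<open>e = 0\<close> and the curve is a segment in direction
      \<open>u\<close>.\<close>
    then show "s = t"
      using st by (cases "u = 0") (auto simp: h_def e_def simp del: scaleR_conv_of_real)
  qed
  then show ?thesis
    using that[OF b(1-3)] b(5) by simp
qed

section \<open>Horizontal lifts\<close>

locale bundle_connection =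
  fixes atlM :: "('m::t2_space, 'k::{real_normed_field,euclidean_space}, 'n::finite) chart set"
    and atlE :: "('e::t2_space, 'k, 'n + 'r::finite) chart set"
    and \<pi> :: "'e \<Rightarrow> 'm"
    and \<Delta> :: "'e \<Rightarrow> ('e, 'k, 'n + 'r) tvec set"
  assumes C1_bundle: "C1_bundle atlM atlE \<pi>"
    and conn: "connection atlM atlE \<pi> \<Delta>"
begin

lemma manifold_base: "C1_manifold atlM" and manifold_total: "C1_manifold atlE"
  and submersion_proj: "submersion atlE atlM \<pi>" and C1_map_proj: "C1_map atlE atlM \<pi>"
  using C1_bundle by (auto simp: C1_bundle_def submersion_def)

lemma subspace_\<Delta>: "tangent.subspace (\<Delta> p)" and dim_\<Delta>: "tangent.dim (\<Delta> p) = CARD('n)"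
  using conn[unfolded connection_def, THEN conjunct1, THEN spec, of p] by auto

lemma tangent_decomp: "tangent_space atlE p = {v + w | v w. v \<in> vertical atlE \<pi> p \<and> w \<in> \<Delta> p}"
  using conn[unfolded connection_def, THEN conjunct2, THEN conjunct1, THEN spec, of p] by (rule conjunct1)

lemma ex1_horizontal_lift:
  "\<gamma> \<in> C1_paths atlM J \<Longrightarrow> s0 \<in> J \<Longrightarrow> \<pi> p = \<gamma> s0 \<Longrightarrow> \<exists>!\<delta>. horizontal_lift atlE \<pi> \<Delta> J \<gamma> \<delta> \<and> \<delta> s0 = p"
  using conn by (simp add: connection_def)

section \<open>The differential of the projection, read in charts, and its restriction to horizontal
  spaces\<close>

abbreviation (input) "dproj c c' p v \<equiv> frechet_derivative (local_rep c c' \<pi>) (at (snd c p)) (v c)"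

text \<open>Only the values of \<open>\<gamma>\<close> on \<open>J\<close> enter, and
  \<open>\<gamma>\<close> is not assumed to be undefined off \<open>J\<close>; a constant function
  can therefore stand for the projection of a path in a fibre.\<close>

lemma dproj_velocity:
  assumes \<delta>: "\<delta> \<in> C1_paths atlE J" "\<And>t. t \<in> J \<Longrightarrow> \<pi> (\<delta> t) = \<gamma> t" and s: "s \<in> J" "J \<noteq> {s}"
    and c: "c \<in> atlE" "c' \<in> atlM" "\<delta> s \<in> fst c" "\<gamma> s \<in> fst c'"
  shows "dproj c c' (\<delta> s) (velocity atlE J \<delta> s) = velocity atlM J \<gamma> s c'"
proof -
  have "((snd c' \<circ> (\<pi> \<circ> \<delta>)) has_vector_derivative dproj c c' (\<delta> s) (velocity atlE J \<delta> s)) (at s within J)"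
    by (rule path_image_derivative[OF manifold_total C1_map_proj \<delta>(1) s(1) c(1-3)]) (use \<delta> s c in simp)
  then have "((snd c' \<circ> \<gamma>) has_vector_derivative dproj c c' (\<delta> s) (velocity atlE J \<delta> s)) (at s within J)"
    by (rule has_vector_derivative_transform[OF s(1), rotated]) (simp add: \<delta>(2))
  from velocity_eqI[OF C1_pathsD(2)[OF \<delta>(1)] s c(2,4) this] show ?thesis
    by simp
qed

text \<open>A vertical vector is the velocity of a path in one fibre, and the projection of that
  path is constant.\<close>

lemma dproj_vertical:
  assumes v: "v \<in> vertical atlE \<pi> p" and c: "c \<in> atlE" "c' \<in> atlM" "p \<in> fst c" "\<pi> p \<in> fst c'"
  shows "dproj c c' p v = 0"
proof -
  obtain J \<gamma> s where \<gamma>: "v = velocity atlE J \<gamma> s" "\<gamma> \<in> C1_paths atlE J" "s \<in> J" "J \<noteq> {s}"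
    "\<gamma> ` J \<subseteq> fibre \<pi> (\<pi> p)" "\<gamma> s = p"
    using v unfolding vertical_def by blast
  have "dproj c c' (\<gamma> s) (velocity atlE J \<gamma> s) = velocity atlM J (\<lambda>_. \<pi> p) s c'"
    by (rule dproj_velocity) (use \<gamma> c in auto)
  also have "\<dots> = 0"
    by (rule velocity_eqI) (use C1_pathsD(2)[OF \<gamma>(2)] \<gamma> c in \<open>auto simp: o_def\<close>)
  finally show ?thesis
    using \<gamma> by simp
qed

lemma dproj_linear:
  assumes "c \<in> atlE" "c' \<in> atlM" "p \<in> fst c" "\<pi> p \<in> fst c'"
  shows "Vector_Spaces.linear tscale (*s) (dproj c c' p)"
proof -
  interpret D: Vector_Spaces.linear "(*s)" "(*s)" "frechet_derivative (local_rep c c' \<pi>) (at (snd c p))"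
    by (rule local_rep_derivative(2)[OF C1_map_proj assms])
  show ?thesis
    by unfold_locales (auto simp: tscale_def D.add D.scale)
qed

text \<open>The differential of the projection is onto and kills vertical vectors, so it maps the
  \<open>n\<close>-dimensional space \<open>\<Delta> p\<close> onto an \<open>n\<close>-dimensional space.\<close>

lemma dproj_inj:
  assumes c: "c \<in> atlE" "c' \<in> atlM" "p \<in> fst c" "\<pi> p \<in> fst c'"
  shows "inj_on (dproj c c' p) (\<Delta> p)"
proof -
  define L where "L = dproj c c' p"
  interpret L: Vector_Spaces.linear tscale "(*s)" L
    unfolding L_def by (rule dproj_linear[OF c])
  obtain B where B: "B \<subseteq> \<Delta> p" "tangent.independent B" "\<Delta> p \<subseteq> tangent.span B" "card B = CARD('n)"
    using tangent.basis_exists[of "\<Delta> p"] dim_\<Delta>[of p] by metis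
  \<comment> \<open>An infinite set has \<open>card\<close> 0, whereas \<open>CARD('n)\<close> is
    positive.\<close>
  have fin: "finite B"
    using B(4) card.infinite by fastforce
  have spans: "UNIV \<subseteq> vec.span (L ` B)"
  proof
    fix u :: "('k, 'n) vec"
    have "surj (frechet_derivative (local_rep c c' \<pi>) (at (snd c p)))"
      using submersion_proj c unfolding submersion_def by blast
    then obtain y where y: "u = frechet_derivative (local_rep c c' \<pi>) (at (snd c p)) y"
      by (meson surjD)
    \<comment> \<open>The coordinate vector \<open>y\<close> has to become a tangent vector, that is
      a compatible family over all charts, before it can be split into a vertical and a horizontal
      part. A curve with this velocity provides the family.\<close>
    obtain \<epsilon> \<beta> where \<beta>: "\<epsilon> > 0" "\<beta> \<in> C1_paths atlE {0..\<epsilon>}" "\<beta> 0 = p" "velocity atlE {0..\<epsilon>} \<beta> 0 c = y"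
      using injective_curve[OF manifold_total c(1,3)] by metis
    have "velocity atlE {0..\<epsilon>} \<beta> 0 \<in> tangent_space atlE (\<beta> 0)"
      by (rule velocity_in_tangent_space[OF manifold_total \<beta>(2)]) (use \<beta>(1) in auto)
    then obtain v w where vw: "velocity atlE {0..\<epsilon>} \<beta> 0 = v + w" "v \<in> vertical atlE \<pi> p" "w \<in> \<Delta> p"
      unfolding \<beta>(3) tangent_decomp by blast
    have "u = L (v + w)"
      using y \<beta>(4) vw(1) by (simp add: L_def)
    also have "\<dots> = L w"
      using dproj_vertical[OF vw(2) c] by (simp add: L.add) (simp add: L_def)
    finally show "u \<in> vec.span (L ` B)"
      using vw(3) B(3) L.span_image by blast
  qed
  have dim: "vec.dim (UNIV :: ('k, 'n) vec set) = CARD('n)"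
    by (rule vec_dim_card)
  have "CARD('n) \<le> card (L ` B)"
    using vec.dim_le_card[OF spans] fin dim by simp
  then have inj: "inj_on L B"
    using B(4) fin card_image_le[OF fin, of L] by (intro eq_card_imp_inj_on) auto
  have "vec.independent (L ` B)"
    by (rule vec.card_le_dim_spanning[OF _ spans]) (use fin dim B(4) card_image_le[OF fin, of L] in auto)
  then have "inj_on L (tangent.span B)"
    by (rule L.inj_on_span_independent_image[OF _ inj])
  then show ?thesis
    unfolding L_def[symmetric] using B(3) inj_on_subset by blast
qed

lemma \<Delta>_eqI:
  assumes "v \<in> \<Delta> p" "w \<in> \<Delta> p" "c \<in> atlE" "c' \<in> atlM" "p \<in> fst c" "\<pi> p \<in> fst c'"
    "dproj c c' p v = dproj c c' p w"
  shows "v = w"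
  using inj_onD[OF dproj_inj[OF assms(3-6)] assms(7,1,2)] .

section \<open>Uniqueness, reparametrisation and restriction of horizontal lifts\<close>

lemma horizontal_liftD:
  assumes "horizontal_lift atlE \<pi> \<Delta> J \<gamma> \<delta>"
  shows "\<delta> \<in> C1_paths atlE J" "s \<in> J \<Longrightarrow> \<pi> (\<delta> s) = \<gamma> s"
    "s \<in> J \<Longrightarrow> J \<noteq> {s} \<Longrightarrow> velocity atlE J \<delta> s \<in> \<Delta> (\<delta> s)"
  using assms by (auto simp: horizontal_lift_def)

lemma horizontal_lift_exists:
  assumes "\<gamma> \<in> C1_paths atlM J" "s0 \<in> J" "\<pi> p = \<gamma> s0"
  obtains \<delta> where "horizontal_lift atlE \<pi> \<Delta> J \<gamma> \<delta>" "\<delta> s0 = p"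
  using ex1_horizontal_lift[OF assms] by blast

lemma horizontal_lift_unique:
  assumes "\<gamma> \<in> C1_paths atlM J" "s0 \<in> J"
    "horizontal_lift atlE \<pi> \<Delta> J \<gamma> \<delta>" "horizontal_lift atlE \<pi> \<Delta> J \<gamma> \<delta>'" "\<delta> s0 = \<delta>' s0"
  shows "\<delta> = \<delta>'"
  using ex1_horizontal_lift[OF assms(1,2) horizontal_liftD(2)[OF assms(3,2)]] assms(3-5) by auto

text \<open>The new velocity is a real multiple of an old one, and the horizontal spaces are
  subspaces; the factor may be negative or zero, so reversal is included.\<close>

lemma horizontal_lift_compose:
  assumes \<delta>: "horizontal_lift atlE \<pi> \<Delta> J \<gamma> \<delta>" and J': "is_interval J'" "J' \<noteq> {}"
    and \<theta>: "C1_on J' \<theta>" "\<theta> ` J' \<subseteq> J" "inj_on \<theta> J'"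
  shows "horizontal_lift atlE \<pi> \<Delta> J' (compose J' \<gamma> \<theta>) (compose J' \<delta> \<theta>)"
proof -
  have "velocity atlE J' (compose J' \<delta> \<theta>) s \<in> \<Delta> (compose J' \<delta> \<theta> s)" if s: "s \<in> J'" "J' \<noteq> {s}" for s
  proof -
    obtain d where d: "(\<theta> has_vector_derivative d) (at s within J')"
      using \<theta>(1) s unfolding C1_on_def by blast
    \<comment> \<open>On a one-point interval a lift has no horizontality condition to pass on.
      Injectivity of \<open>\<theta>\<close> ensures that \<open>J\<close> has a second point
      whenever \<open>J'\<close> has one.\<close>
    have "J \<noteq> {\<theta> s}"
    proof
      assume "J = {\<theta> s}"
      then have "J' = {s}"
        using \<theta>(2,3) s by (force simp: inj_on_def)
      then show False using s by simp
    qed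
    then have "velocity atlE J \<delta> (\<theta> s) \<in> \<Delta> (\<delta> (\<theta> s))"
      using horizontal_liftD(3)[OF \<delta>] \<theta>(2) s by blast
    then have "tscale (of_real d) (velocity atlE J \<delta> (\<theta> s)) \<in> \<Delta> (\<delta> (\<theta> s))"
      by (rule tangent.subspace_scale[OF subspace_\<Delta>])
    then show ?thesis
      using velocity_compose[OF manifold_total horizontal_liftD(1)[OF \<delta>] J'(1) s d \<theta>(2)] s
      by (simp add: compose_def)
  qed
  then show ?thesis
    using C1_paths_compose[OF horizontal_liftD(1)[OF \<delta>] J' \<theta>(1,2)] horizontal_liftD(2)[OF \<delta>] \<theta>(2)
    by (auto simp: horizontal_lift_def compose_def)
qed

lemma horizontal_lift_restrict:
  assumes "horizontal_lift atlE \<pi> \<Delta> J \<gamma> \<delta>" "is_interval J'" "J' \<noteq> {}" "J' \<subseteq> J"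
  shows "horizontal_lift atlE \<pi> \<Delta> J' (restrict \<gamma> J') (restrict \<delta> J')"
  using horizontal_lift_compose[OF assms(1-3) C1_on_ident] assms(4) by (simp add: compose_def)

section \<open>The transport assigned to a connection\<close>

abbreviation "lift_transport \<equiv> assigned_transport atlM atlE \<pi> \<Delta>"

text \<open>This resolves the definite description in \<open>assigned_transport\<close>: from here
  on it suffices to exhibit some horizontal lift and to read the transport off its two end
  values.\<close>

lemma assigned_transport_eq:
  assumes \<gamma>: "\<gamma> \<in> C1_paths atlM {\<sigma>..\<tau>}" and \<delta>: "horizontal_lift atlE \<pi> \<Delta> {\<sigma>..\<tau>} \<gamma> \<delta>"
  shows "lift_transport \<sigma> \<tau> \<gamma> (\<delta> \<sigma>) = \<delta> \<tau>"
proof -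
  have \<sigma>: "\<sigma> \<in> {\<sigma>..\<tau>}"
    using C1_pathsD(3)[OF \<gamma>] by simp
  have "(THE \<delta>'. horizontal_lift atlE \<pi> \<Delta> {\<sigma>..\<tau>} \<gamma> \<delta>' \<and> \<delta>' \<sigma> = \<delta> \<sigma>) = \<delta>"
    by (rule the_equality) (use \<delta> horizontal_lift_unique[OF \<gamma> \<sigma>] in auto)
  then show ?thesis
    using \<gamma> horizontal_liftD(2)[OF \<delta> \<sigma>] by (simp add: assigned_transport_def)
qed

lemma horizontal_lift_from:
  assumes "\<gamma> \<in> C1_paths atlM {\<sigma>..\<tau>}" "p \<in> fibre \<pi> (\<gamma> \<sigma>)"
  obtains \<delta> where "horizontal_lift atlE \<pi> \<Delta> {\<sigma>..\<tau>} \<gamma> \<delta>" "\<delta> \<sigma> = p" "\<delta> \<tau> \<in> fibre \<pi> (\<gamma> \<tau>)"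
proof -
  have le: "\<sigma> \<le> \<tau>"
    using C1_pathsD(3)[OF assms(1)] by simp
  obtain \<delta> where \<delta>: "horizontal_lift atlE \<pi> \<Delta> {\<sigma>..\<tau>} \<gamma> \<delta>" "\<delta> \<sigma> = p"
    by (rule horizontal_lift_exists[OF assms(1), of \<sigma> p]) (use assms(2) le in auto)
  moreover have "\<delta> \<tau> \<in> fibre \<pi> (\<gamma> \<tau>)"
    using horizontal_liftD(2)[OF \<delta>(1)] le by simp
  ultimately show ?thesis
    using that by blast
qed

lemma assigned_transport_extensional:
  "\<gamma> \<in> C1_paths atlM {\<sigma>..\<tau>} \<Longrightarrow> lift_transport \<sigma> \<tau> \<gamma> \<in> extensional (fibre \<pi> (\<gamma> \<sigma>))"
  by (simp add: assigned_transport_def)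

lemma transport_maps_assigned: "transport_maps atlM \<pi> lift_transport"
proof -
  have "lift_transport \<sigma> \<tau> \<gamma> \<in> fibre \<pi> (\<gamma> \<sigma>) \<rightarrow>\<^sub>E fibre \<pi> (\<gamma> \<tau>)" if \<gamma>: "\<gamma> \<in> C1_paths atlM {\<sigma>..\<tau>}" for \<sigma> \<tau> \<gamma>
  proof (rule PiE_I)
    fix p assume "p \<in> fibre \<pi> (\<gamma> \<sigma>)"
    then obtain \<delta> where "horizontal_lift atlE \<pi> \<Delta> {\<sigma>..\<tau>} \<gamma> \<delta>" "\<delta> \<sigma> = p" "\<delta> \<tau> \<in> fibre \<pi> (\<gamma> \<tau>)"
      using horizontal_lift_from[OF \<gamma>] by blast
    then show "lift_transport \<sigma> \<tau> \<gamma> p \<in> fibre \<pi> (\<gamma> \<tau>)"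
      using assigned_transport_eq[OF \<gamma>] by metis
  qed (use assigned_transport_extensional[OF \<gamma>] in \<open>simp add: extensional_def\<close>)
  then show ?thesis
    by (simp add: transport_maps_def assigned_transport_def)
qed

text \<open>Lifts exist and are unique for a prescribed value at any time of the interval. Using
  this at \<open>\<tau>\<close> gives both injectivity and surjectivity.\<close>

lemma assigned_transport_bij:
  assumes \<gamma>: "\<gamma> \<in> C1_paths atlM {\<sigma>..\<tau>}"
  shows "bij_betw (lift_transport \<sigma> \<tau> \<gamma>) (fibre \<pi> (\<gamma> \<sigma>)) (fibre \<pi> (\<gamma> \<tau>))"
proof -
  have mem: "\<sigma> \<in> {\<sigma>..\<tau>}" "\<tau> \<in> {\<sigma>..\<tau>}"
    using C1_pathsD(3)[OF \<gamma>] by auto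
  have "inj_on (lift_transport \<sigma> \<tau> \<gamma>) (fibre \<pi> (\<gamma> \<sigma>))"
  proof (rule inj_onI)
    fix p q assume pq: "p \<in> fibre \<pi> (\<gamma> \<sigma>)" "q \<in> fibre \<pi> (\<gamma> \<sigma>)" "lift_transport \<sigma> \<tau> \<gamma> p = lift_transport \<sigma> \<tau> \<gamma> q"
    obtain \<delta> where \<delta>: "horizontal_lift atlE \<pi> \<Delta> {\<sigma>..\<tau>} \<gamma> \<delta>" "\<delta> \<sigma> = p"
      using horizontal_lift_from[OF \<gamma> pq(1)] by blast
    obtain \<delta>' where \<delta>': "horizontal_lift atlE \<pi> \<Delta> {\<sigma>..\<tau>} \<gamma> \<delta>'" "\<delta>' \<sigma> = q"
      using horizontal_lift_from[OF \<gamma> pq(2)] by blast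
    have "\<delta> \<tau> = \<delta>' \<tau>"
      using pq(3) assigned_transport_eq[OF \<gamma>] \<delta> \<delta>' by metis
    then show "p = q"
      using horizontal_lift_unique[OF \<gamma> mem(2) \<delta>(1) \<delta>'(1)] \<delta>(2) \<delta>'(2) by simp
  qed
  moreover have "q \<in> lift_transport \<sigma> \<tau> \<gamma> ` fibre \<pi> (\<gamma> \<sigma>)" if q: "q \<in> fibre \<pi> (\<gamma> \<tau>)" for q
  proof -
    obtain \<delta> where \<delta>: "horizontal_lift atlE \<pi> \<Delta> {\<sigma>..\<tau>} \<gamma> \<delta>" "\<delta> \<tau> = q"
      by (rule horizontal_lift_exists[OF \<gamma> mem(2), of q]) (use q in auto)
    have "lift_transport \<sigma> \<tau> \<gamma> (\<delta> \<sigma>) = q"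
      using assigned_transport_eq[OF \<gamma> \<delta>(1)] \<delta>(2) by simp
    moreover have "\<delta> \<sigma> \<in> fibre \<pi> (\<gamma> \<sigma>)"
      using horizontal_liftD(2)[OF \<delta>(1) mem(1)] by simp
    ultimately show ?thesis by blast
  qed
  moreover have "lift_transport \<sigma> \<tau> \<gamma> ` fibre \<pi> (\<gamma> \<sigma>) \<subseteq> fibre \<pi> (\<gamma> \<tau>)"
    using transport_maps_assigned \<gamma> unfolding transport_maps_def by (meson PiE_mem image_subsetI)
  ultimately show ?thesis
    by (intro bij_betw_imageI) blast+
qed

lemma assigned_transport_inv_into:
  assumes \<gamma>: "\<gamma> \<in> C1_paths atlM {\<sigma>..\<tau>}" and \<delta>: "horizontal_lift atlE \<pi> \<Delta> {\<sigma>..\<tau>} \<gamma> \<delta>"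
  shows "inv_into (fibre \<pi> (\<gamma> \<sigma>)) (lift_transport \<sigma> \<tau> \<gamma>) (\<delta> \<tau>) = \<delta> \<sigma>"
proof -
  have "\<delta> \<sigma> \<in> fibre \<pi> (\<gamma> \<sigma>)"
    using horizontal_liftD(2)[OF \<delta>, of \<sigma>] C1_pathsD(3)[OF \<gamma>] by simp
  then show ?thesis
    using inv_into_f_f[OF bij_betw_imp_inj_on[OF assigned_transport_bij[OF \<gamma>]]]
    unfolding assigned_transport_eq[OF assms, symmetric] by blast
qed

text \<open>The restriction of a lift to \<open>{\<sigma>..s}\<close> lifts the restricted path, so
  transporting the initial point up to \<open>s\<close> gives the value of the lift at
  \<open>s\<close>.\<close>

lemma lifted_path_assigned:
  assumes \<gamma>: "\<gamma> \<in> C1_paths atlM {\<sigma>..\<tau>}" and \<delta>: "horizontal_lift atlE \<pi> \<Delta> {\<sigma>..\<tau>} \<gamma> \<delta>"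
  shows "lifted_path lift_transport \<sigma> \<tau> \<gamma> (\<delta> \<sigma>) = \<delta>"
proof (rule extensionalityI)
  show "lifted_path lift_transport \<sigma> \<tau> \<gamma> (\<delta> \<sigma>) \<in> extensional {\<sigma>..\<tau>}"
    by (simp add: lifted_path_def)
  show "\<delta> \<in> extensional {\<sigma>..\<tau>}"
    by (rule C1_pathsD(1)[OF horizontal_liftD(1)[OF \<delta>]])
  fix s assume s: "s \<in> {\<sigma>..\<tau>}"
  have sub: "is_interval {\<sigma>..s}" "{\<sigma>..s} \<noteq> {}" "{\<sigma>..s} \<subseteq> {\<sigma>..\<tau>}"
    using s by (auto simp: is_interval_cc)
  show "lifted_path lift_transport \<sigma> \<tau> \<gamma> (\<delta> \<sigma>) s = \<delta> s"
    using assigned_transport_eq[OF C1_paths_restrict[OF \<gamma> sub] horizontal_lift_restrict[OF \<delta> sub]] s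
    by (simp add: lifted_path_def)
qed

lemma assigned_transport_reparam:
  assumes \<gamma>: "\<gamma> \<in> C1_paths atlM {\<sigma>..\<tau>}" and \<theta>: "orientation_preserving_C1_diffeo {\<sigma>'..\<tau>'} {\<sigma>..\<tau>} \<theta>"
  shows "lift_transport \<sigma>' \<tau>' (compose {\<sigma>'..\<tau>'} \<gamma> \<theta>) = lift_transport \<sigma> \<tau> \<gamma>"
proof -
  have "\<sigma> \<le> \<tau>"
    using C1_pathsD(3)[OF \<gamma>] by simp
  note ends = orientation_preserving_C1_diffeo_endpoints[OF \<theta> this]
  have \<theta>': "is_interval {\<sigma>'..\<tau>'}" "{\<sigma>'..\<tau>'} \<noteq> {}" "C1_on {\<sigma>'..\<tau>'} \<theta>" "\<theta> ` {\<sigma>'..\<tau>'} \<subseteq> {\<sigma>..\<tau>}" "inj_on \<theta> {\<sigma>'..\<tau>'}"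
    using \<theta> ends by (auto simp: orientation_preserving_C1_diffeo_def bij_betw_def is_interval_cc)
  have \<gamma>': "compose {\<sigma>'..\<tau>'} \<gamma> \<theta> \<in> C1_paths atlM {\<sigma>'..\<tau>'}"
    by (rule C1_paths_compose[OF \<gamma> \<theta>'(1-4)])
  have start: "compose {\<sigma>'..\<tau>'} \<gamma> \<theta> \<sigma>' = \<gamma> \<sigma>"
    using ends by (simp add: compose_def)
  show ?thesis
  proof (rule extensionalityI)
    show "lift_transport \<sigma>' \<tau>' (compose {\<sigma>'..\<tau>'} \<gamma> \<theta>) \<in> extensional (fibre \<pi> (\<gamma> \<sigma>))"
      using assigned_transport_extensional[OF \<gamma>'] unfolding start .
    show "lift_transport \<sigma> \<tau> \<gamma> \<in> extensional (fibre \<pi> (\<gamma> \<sigma>))"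
      by (rule assigned_transport_extensional[OF \<gamma>])
    fix p assume "p \<in> fibre \<pi> (\<gamma> \<sigma>)"
    then obtain \<delta> where \<delta>: "horizontal_lift atlE \<pi> \<Delta> {\<sigma>..\<tau>} \<gamma> \<delta>" "\<delta> \<sigma> = p"
      using horizontal_lift_from[OF \<gamma>] by blast
    show "lift_transport \<sigma>' \<tau>' (compose {\<sigma>'..\<tau>'} \<gamma> \<theta>) p = lift_transport \<sigma> \<tau> \<gamma> p"
      using assigned_transport_eq[OF \<gamma>' horizontal_lift_compose[OF \<delta>(1) \<theta>']]
        assigned_transport_eq[OF \<gamma> \<delta>(1)] \<delta>(2) ends(1-3) by (simp add: compose_eq)
  qed
qed

lemma assigned_transport_inverse_path:
  assumes \<gamma>: "\<gamma> \<in> C1_paths atlM {0..1}"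
  shows "lift_transport 0 1 (inverse_path \<gamma>) = restrict (inv_into (fibre \<pi> (\<gamma> 0)) (lift_transport 0 1 \<gamma>)) (fibre \<pi> (\<gamma> 1))"
proof -
  have inv: "inverse_path \<alpha> = compose {0..1} \<alpha> (\<lambda>t. - 1 * t + 1)" for \<alpha> :: "real \<Rightarrow> 'z"
    by (simp add: inverse_path_def compose_def)
  have \<theta>: "is_interval {0..1::real}" "{0..1::real} \<noteq> {}" "C1_on {0..1} (\<lambda>t::real. - 1 * t + 1)"
    "(\<lambda>t::real. - 1 * t + 1) ` {0..1} \<subseteq> {0..1}" "inj_on (\<lambda>t::real. - 1 * t + 1) {0..1}"
    using C1_on_affine[of "{0..1}" "- 1" 1] by (auto simp: is_interval_cc inj_on_def)
  have \<gamma>': "inverse_path \<gamma> \<in> C1_paths atlM {0..1}"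
    unfolding inv by (rule C1_paths_compose[OF \<gamma> \<theta>(1-4)])
  have start: "inverse_path \<gamma> 0 = \<gamma> 1"
    by (simp add: inverse_path_def)
  show ?thesis
  proof (rule extensionalityI)
    show "lift_transport 0 1 (inverse_path \<gamma>) \<in> extensional (fibre \<pi> (\<gamma> 1))"
      using assigned_transport_extensional[OF \<gamma>'] unfolding start .
    fix p assume p: "p \<in> fibre \<pi> (\<gamma> 1)"
    obtain \<delta> where \<delta>: "horizontal_lift atlE \<pi> \<Delta> {0..1} \<gamma> \<delta>" "\<delta> 1 = p"
      by (rule horizontal_lift_exists[OF \<gamma>, of 1 p]) (use p in auto)
    have "horizontal_lift atlE \<pi> \<Delta> {0..1} (inverse_path \<gamma>) (inverse_path \<delta>)"
      unfolding inv by (rule horizontal_lift_compose[OF \<delta>(1) \<theta>])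
    from assigned_transport_eq[OF \<gamma>' this] have "lift_transport 0 1 (inverse_path \<gamma>) p = \<delta> 0"
      using \<delta>(2) by (simp add: inverse_path_def)
    then show "lift_transport 0 1 (inverse_path \<gamma>) p =
        restrict (inv_into (fibre \<pi> (\<gamma> 0)) (lift_transport 0 1 \<gamma>)) (fibre \<pi> (\<gamma> 1)) p"
      using assigned_transport_inv_into[OF \<gamma> \<delta>(1)] \<delta>(2) p by simp
  qed simp
qed

lemma assigned_transport_product_path:
  assumes \<gamma>1: "\<gamma>1 \<in> C1_paths atlM {0..1}" and \<gamma>2: "\<gamma>2 \<in> C1_paths atlM {0..1}" and eq: "\<gamma>1 1 = \<gamma>2 0"
    and \<gamma>: "product_path \<gamma>1 \<gamma>2 \<in> C1_paths atlM {0..1}"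
  shows "lift_transport 0 1 (product_path \<gamma>1 \<gamma>2) = compose (fibre \<pi> (\<gamma>1 0)) (lift_transport 0 1 \<gamma>2) (lift_transport 0 1 \<gamma>1)"
proof -
  have half: "C1_on {0..1} (\<lambda>t::real. 1/2 * t + b)" "inj_on (\<lambda>t::real. 1/2 * t + b) {0..1}" for b
    by (rule C1_on_affine) (simp add: inj_on_def)
  have img: "(\<lambda>t::real. 1/2 * t + 0) ` {0..1} \<subseteq> {0..1}" "(\<lambda>t::real. 1/2 * t + 1/2) ` {0..1} \<subseteq> {0..1}"
    by auto
  have I: "is_interval {0..1::real}" "{0..1::real} \<noteq> {}"
    by (auto simp: is_interval_cc)
  have g1: "compose {0..1} (product_path \<gamma>1 \<gamma>2) (\<lambda>t. 1/2 * t + 0) = \<gamma>1"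
    by (rule extensionalityI[OF compose_extensional C1_pathsD(1)[OF \<gamma>1]])
      (auto simp: compose_def product_path_def)
  have g2: "compose {0..1} (product_path \<gamma>1 \<gamma>2) (\<lambda>t. 1/2 * t + 1/2) = \<gamma>2"
  proof (rule extensionalityI[OF compose_extensional C1_pathsD(1)[OF \<gamma>2]])
    fix t :: real assume "t \<in> {0..1}"
    \<comment> \<open>At \<open>t = 0\<close> the argument is 1/2, where \<open>product_path\<close>
      still takes its first branch with value \<open>\<gamma>1 1\<close>; this is where the two
      paths have to match.\<close>
    then show "compose {0..1} (product_path \<gamma>1 \<gamma>2) (\<lambda>t. 1/2 * t + 1/2) t = \<gamma>2 t"
      using eq by (cases "t = 0") (auto simp: compose_def product_path_def)
  qed
  have start: "product_path \<gamma>1 \<gamma>2 0 = \<gamma>1 0"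
    by (simp add: product_path_def)
  show ?thesis
  proof (rule extensionalityI)
    show "lift_transport 0 1 (product_path \<gamma>1 \<gamma>2) \<in> extensional (fibre \<pi> (\<gamma>1 0))"
      using assigned_transport_extensional[OF \<gamma>] unfolding start .
    show "compose (fibre \<pi> (\<gamma>1 0)) (lift_transport 0 1 \<gamma>2) (lift_transport 0 1 \<gamma>1) \<in> extensional (fibre \<pi> (\<gamma>1 0))"
      by (rule compose_extensional)
    fix p assume p: "p \<in> fibre \<pi> (\<gamma>1 0)"
    \<comment> \<open>The lift of the product is cut into two halves. Gluing lifts of the two
      factors would call for a proof that the result is C1 at the junction.\<close>
    obtain \<delta> where \<delta>: "horizontal_lift atlE \<pi> \<Delta> {0..1} (product_path \<gamma>1 \<gamma>2) \<delta>" "\<delta> 0 = p"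
      by (rule horizontal_lift_exists[OF \<gamma>, of 0 p]) (use p start in auto)
    have \<delta>1: "horizontal_lift atlE \<pi> \<Delta> {0..1} \<gamma>1 (compose {0..1} \<delta> (\<lambda>t. 1/2 * t + 0))"
      using horizontal_lift_compose[OF \<delta>(1) I half(1) img(1) half(2)] unfolding g1 .
    have \<delta>2: "horizontal_lift atlE \<pi> \<Delta> {0..1} \<gamma>2 (compose {0..1} \<delta> (\<lambda>t. 1/2 * t + 1/2))"
      using horizontal_lift_compose[OF \<delta>(1) I half(1) img(2) half(2)] unfolding g2 .
    have "lift_transport 0 1 \<gamma>1 p = \<delta> (1/2)"
      using assigned_transport_eq[OF \<gamma>1 \<delta>1] \<delta>(2) by (simp add: compose_def)
    moreover have "lift_transport 0 1 \<gamma>2 (\<delta> (1/2)) = \<delta> 1"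
      using assigned_transport_eq[OF \<gamma>2 \<delta>2] by (simp add: compose_def)
    moreover have "lift_transport 0 1 (product_path \<gamma>1 \<gamma>2) p = \<delta> 1"
      using assigned_transport_eq[OF \<gamma> \<delta>(1)] \<delta>(2) by simp
    ultimately show "lift_transport 0 1 (product_path \<gamma>1 \<gamma>2) p =
        compose (fibre \<pi> (\<gamma>1 0)) (lift_transport 0 1 \<gamma>2) (lift_transport 0 1 \<gamma>1) p"
      using p by (simp add: compose_def)
  qed
qed

lemma assigned_transport_const: "lift_transport r r (\<lambda>t\<in>{r..r}. x) = (\<lambda>p\<in>fibre \<pi> x. p)"
proof -
  have \<gamma>: "(\<lambda>t\<in>{r..r}. x) \<in> C1_paths atlM {r..r}"
    using C1_paths_singleton[where r = r and x = x and A = atlM] by simp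
  show ?thesis
  proof (rule extensionalityI)
    show "lift_transport r r (\<lambda>t\<in>{r..r}. x) \<in> extensional (fibre \<pi> x)"
      using assigned_transport_extensional[OF \<gamma>] by simp
    fix p assume p: "p \<in> fibre \<pi> x"
    then obtain \<delta> where "horizontal_lift atlE \<pi> \<Delta> {r..r} (\<lambda>t\<in>{r..r}. x) \<delta>" "\<delta> r = p"
      using horizontal_lift_from[OF \<gamma>, of p] by auto
    then have "lift_transport r r (\<lambda>t\<in>{r..r}. x) p = p"
      using assigned_transport_eq[OF \<gamma>] by metis
    then show "lift_transport r r (\<lambda>t\<in>{r..r}. x) p = (\<lambda>p\<in>fibre \<pi> x. p) p"
      using p by simp
  qed simp
qed

section \<open>Initial velocities of horizontal lifts\<close>

lemma horizontal_velocity_eqI: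
  assumes \<delta>: "horizontal_lift atlE \<pi> \<Delta> J \<gamma> \<delta>" and s: "s \<in> J" "J \<noteq> {s}" and w: "w \<in> \<Delta> (\<delta> s)"
    and c: "c \<in> atlE" "c' \<in> atlM" "\<delta> s \<in> fst c" "\<gamma> s \<in> fst c'"
    and eq: "velocity atlM J \<gamma> s c' = dproj c c' (\<delta> s) w"
  shows "velocity atlE J \<delta> s = w"
proof (rule \<Delta>_eqI[OF _ w c(1-3)])
  show "velocity atlE J \<delta> s \<in> \<Delta> (\<delta> s)"
    by (rule horizontal_liftD(3)[OF \<delta> s])
  show "\<pi> (\<delta> s) \<in> fst c'"
    using horizontal_liftD(2)[OF \<delta> s(1)] c(4) by simp
  show "dproj c c' (\<delta> s) (velocity atlE J \<delta> s) = dproj c c' (\<delta> s) w"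
    using dproj_velocity[OF horizontal_liftD(1,2)[OF \<delta>] s c] eq by simp
qed

lemma assigned_initial_velocity_eq:
  assumes \<gamma>1: "\<gamma>1 \<in> C1_paths atlM {\<sigma>1..\<tau>1}" and \<gamma>2: "\<gamma>2 \<in> C1_paths atlM {\<sigma>2..\<tau>2}"
    and p: "p \<in> fibre \<pi> (\<gamma>1 \<sigma>1)"
    and lt: "\<sigma>1 < \<tau>1" "\<sigma>2 < \<tau>2" and eq: "\<gamma>1 \<sigma>1 = \<gamma>2 \<sigma>2"
    and vel: "velocity atlM {\<sigma>1..\<tau>1} \<gamma>1 \<sigma>1 = velocity atlM {\<sigma>2..\<tau>2} \<gamma>2 \<sigma>2"
  shows "velocity atlE {\<sigma>1..\<tau>1} (lifted_path lift_transport \<sigma>1 \<tau>1 \<gamma>1 p) \<sigma>1 =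
    velocity atlE {\<sigma>2..\<tau>2} (lifted_path lift_transport \<sigma>2 \<tau>2 \<gamma>2 p) \<sigma>2"
proof -
  obtain \<delta>1 where \<delta>1: "horizontal_lift atlE \<pi> \<Delta> {\<sigma>1..\<tau>1} \<gamma>1 \<delta>1" "\<delta>1 \<sigma>1 = p"
    using horizontal_lift_from[OF \<gamma>1 p] by blast
  obtain \<delta>2 where \<delta>2: "horizontal_lift atlE \<pi> \<Delta> {\<sigma>2..\<tau>2} \<gamma>2 \<delta>2" "\<delta>2 \<sigma>2 = p"
    using horizontal_lift_from[OF \<gamma>2] p eq by metis
  obtain c c' where c: "c \<in> atlE" "c' \<in> atlM" "p \<in> fst c" "\<gamma>1 \<sigma>1 \<in> fst c'"
    using C1_manifold_cover[OF manifold_base] C1_manifold_cover[OF manifold_total] by metis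
  have v2: "velocity atlE {\<sigma>2..\<tau>2} \<delta>2 \<sigma>2 \<in> \<Delta> p"
    using horizontal_liftD(3)[OF \<delta>2(1), of \<sigma>2] lt \<delta>2(2) by auto
  have "velocity atlE {\<sigma>1..\<tau>1} \<delta>1 \<sigma>1 = velocity atlE {\<sigma>2..\<tau>2} \<delta>2 \<sigma>2"
  proof (rule horizontal_velocity_eqI[OF \<delta>1(1)])
    show "velocity atlM {\<sigma>1..\<tau>1} \<gamma>1 \<sigma>1 c' = dproj c c' (\<delta>1 \<sigma>1) (velocity atlE {\<sigma>2..\<tau>2} \<delta>2 \<sigma>2)"
      using dproj_velocity[OF horizontal_liftD(1,2)[OF \<delta>2(1)], of \<sigma>2 c c'] lt c \<delta>1(2) \<delta>2(2) vel eq
      by auto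
  qed (use lt v2 c \<delta>1(2) in auto)
  then show ?thesis
    using lifted_path_assigned[OF \<gamma>1 \<delta>1(1)] lifted_path_assigned[OF \<gamma>2 \<delta>2(1)] \<delta>1(2) \<delta>2(2) by simp
qed

lemma assigned_initial_velocity_combination:
  assumes \<gamma>1: "\<gamma>1 \<in> C1_paths atlM {\<sigma>1..\<tau>1}" and \<gamma>2: "\<gamma>2 \<in> C1_paths atlM {\<sigma>2..\<tau>2}"
    and lt: "\<sigma>1 < \<tau>1" "\<sigma>2 < \<tau>2" and eq: "\<gamma>1 \<sigma>1 = \<gamma>2 \<sigma>2"
  obtains \<sigma>3 \<tau>3 \<gamma>3 where "\<sigma>3 < \<tau>3" "\<gamma>3 \<in> C1_paths atlM {\<sigma>3..\<tau>3}" "\<gamma>3 \<sigma>3 = \<gamma>1 \<sigma>1"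
    "\<And>p. p \<in> fibre \<pi> (\<gamma>3 \<sigma>3) \<Longrightarrow> velocity atlE {\<sigma>3..\<tau>3} (lifted_path lift_transport \<sigma>3 \<tau>3 \<gamma>3 p) \<sigma>3 =
      tscale a1 (velocity atlE {\<sigma>1..\<tau>1} (lifted_path lift_transport \<sigma>1 \<tau>1 \<gamma>1 p) \<sigma>1) +
      tscale a2 (velocity atlE {\<sigma>2..\<tau>2} (lifted_path lift_transport \<sigma>2 \<tau>2 \<gamma>2 p) \<sigma>2)"
proof -
  obtain c' where c': "c' \<in> atlM" "\<gamma>1 \<sigma>1 \<in> fst c'"
    using C1_manifold_cover[OF manifold_base] by metis
  \<comment> \<open>The path has to serve all points of the fibre at once. It can be chosen before
    \<open>p\<close>, because only the base velocities enter, and a single base chart is enough to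
    compare them.\<close>
  obtain \<epsilon> \<gamma>3 where \<gamma>3: "\<epsilon> > 0" "\<gamma>3 \<in> C1_paths atlM {0..\<epsilon>}" "\<gamma>3 0 = \<gamma>1 \<sigma>1"
    "velocity atlM {0..\<epsilon>} \<gamma>3 0 c' =
      a1 *s velocity atlM {\<sigma>1..\<tau>1} \<gamma>1 \<sigma>1 c' + a2 *s velocity atlM {\<sigma>2..\<tau>2} \<gamma>2 \<sigma>2 c'"
    using injective_curve[OF manifold_base c'] by metis
  have "velocity atlE {0..\<epsilon>} (lifted_path lift_transport 0 \<epsilon> \<gamma>3 p) 0 =
      tscale a1 (velocity atlE {\<sigma>1..\<tau>1} (lifted_path lift_transport \<sigma>1 \<tau>1 \<gamma>1 p) \<sigma>1) +
      tscale a2 (velocity atlE {\<sigma>2..\<tau>2} (lifted_path lift_transport \<sigma>2 \<tau>2 \<gamma>2 p) \<sigma>2)"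
    if p: "p \<in> fibre \<pi> (\<gamma>3 0)" for p
  proof -
    obtain \<delta>1 where \<delta>1: "horizontal_lift atlE \<pi> \<Delta> {\<sigma>1..\<tau>1} \<gamma>1 \<delta>1" "\<delta>1 \<sigma>1 = p"
      using horizontal_lift_from[OF \<gamma>1] p \<gamma>3(3) by metis
    obtain \<delta>2 where \<delta>2: "horizontal_lift atlE \<pi> \<Delta> {\<sigma>2..\<tau>2} \<gamma>2 \<delta>2" "\<delta>2 \<sigma>2 = p"
      using horizontal_lift_from[OF \<gamma>2] p \<gamma>3(3) eq by metis
    obtain \<delta>3 where \<delta>3: "horizontal_lift atlE \<pi> \<Delta> {0..\<epsilon>} \<gamma>3 \<delta>3" "\<delta>3 0 = p"
      using horizontal_lift_from[OF \<gamma>3(2) p] by metis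
    obtain c where c: "c \<in> atlE" "p \<in> fst c"
      using C1_manifold_cover[OF manifold_total] by metis
    let ?v1 = "velocity atlE {\<sigma>1..\<tau>1} \<delta>1 \<sigma>1" and ?v2 = "velocity atlE {\<sigma>2..\<tau>2} \<delta>2 \<sigma>2"
    have v: "?v1 \<in> \<Delta> p" "?v2 \<in> \<Delta> p"
      using horizontal_liftD(3)[OF \<delta>1(1), of \<sigma>1] horizontal_liftD(3)[OF \<delta>2(1), of \<sigma>2] lt \<delta>1(2) \<delta>2(2) by auto
    have d: "dproj c c' p ?v1 = velocity atlM {\<sigma>1..\<tau>1} \<gamma>1 \<sigma>1 c'"
      "dproj c c' p ?v2 = velocity atlM {\<sigma>2..\<tau>2} \<gamma>2 \<sigma>2 c'"
      using dproj_velocity[OF horizontal_liftD(1,2)[OF \<delta>1(1)], of \<sigma>1 c c']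
        dproj_velocity[OF horizontal_liftD(1,2)[OF \<delta>2(1)], of \<sigma>2 c c'] lt c c' \<delta>1(2) \<delta>2(2) eq
      by auto
    interpret L: Vector_Spaces.linear tscale "(*s)" "dproj c c' p"
      by (rule dproj_linear) (use c c' p \<gamma>3(3) in auto)
    have "velocity atlE {0..\<epsilon>} \<delta>3 0 = tscale a1 ?v1 + tscale a2 ?v2"
    proof (rule horizontal_velocity_eqI[OF \<delta>3(1)])
      show "tscale a1 ?v1 + tscale a2 ?v2 \<in> \<Delta> (\<delta>3 0)"
        unfolding \<delta>3(2) using v subspace_\<Delta>
        by (intro tangent.subspace_add tangent.subspace_scale)
      show "velocity atlM {0..\<epsilon>} \<gamma>3 0 c' = dproj c c' (\<delta>3 0) (tscale a1 ?v1 + tscale a2 ?v2)"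
        unfolding \<delta>3(2) L.add L.scale d \<gamma>3(4) ..
    qed (use \<gamma>3 c c' \<delta>3(2) in auto)
    then show ?thesis
      using lifted_path_assigned[OF \<gamma>1 \<delta>1(1)] lifted_path_assigned[OF \<gamma>2 \<delta>2(1)]
        lifted_path_assigned[OF \<gamma>3(2) \<delta>3(1)] \<delta>1(2) \<delta>2(2) \<delta>3(2) by simp
  qed
  then show ?thesis
    using that[OF \<gamma>3(1-3)] by blast
qed

lemma parallel_transport_assigned: "parallel_transport atlM atlE \<pi> lift_transport"
  unfolding parallel_transport_def
proof (intro conjI allI ballI impI; (elim conjE)?)
  fix \<sigma> \<tau> \<gamma> p assume \<gamma>: "\<gamma> \<in> C1_paths atlM {\<sigma>..\<tau>}" and p: "p \<in> fibre \<pi> (\<gamma> \<sigma>)"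
  obtain \<delta> where "horizontal_lift atlE \<pi> \<Delta> {\<sigma>..\<tau>} \<gamma> \<delta>" "\<delta> \<sigma> = p"
    using horizontal_lift_from[OF \<gamma> p] by blast
  then show "lifted_path lift_transport \<sigma> \<tau> \<gamma> p \<in> C1_paths atlE {\<sigma>..\<tau>}"
    using lifted_path_assigned[OF \<gamma>] horizontal_liftD(1) by metis
next
  fix \<sigma>1 \<tau>1 \<sigma>2 \<tau>2 \<gamma>1 \<gamma>2 and a1 a2 :: 'k
  assume "\<gamma>1 \<in> C1_paths atlM {\<sigma>1..\<tau>1}" "\<gamma>2 \<in> C1_paths atlM {\<sigma>2..\<tau>2}" "\<sigma>1 < \<tau>1" "\<sigma>2 < \<tau>2" "\<gamma>1 \<sigma>1 = \<gamma>2 \<sigma>2"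
  from assigned_initial_velocity_combination[OF this, of a1 a2]
  show "\<exists>\<sigma>3 \<tau>3. \<sigma>3 < \<tau>3 \<and> (\<exists>\<gamma>3\<in>C1_paths atlM {\<sigma>3..\<tau>3}. \<gamma>3 \<sigma>3 = \<gamma>1 \<sigma>1 \<and>
      (\<forall>p\<in>fibre \<pi> (\<gamma>3 \<sigma>3). velocity atlE {\<sigma>3..\<tau>3} (lifted_path lift_transport \<sigma>3 \<tau>3 \<gamma>3 p) \<sigma>3 =
        tscale a1 (velocity atlE {\<sigma>1..\<tau>1} (lifted_path lift_transport \<sigma>1 \<tau>1 \<gamma>1 p) \<sigma>1) +
        tscale a2 (velocity atlE {\<sigma>2..\<tau>2} (lifted_path lift_transport \<sigma>2 \<tau>2 \<gamma>2 p) \<sigma>2)))"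
    by metis
qed (fact transport_maps_assigned assigned_transport_reparam assigned_transport_bij
  assigned_transport_inverse_path assigned_transport_product_path assigned_transport_const
  assigned_initial_velocity_eq)+

section \<open>The connection generated by the assigned transport\<close>

lemma transport_along_assigned:
  assumes \<gamma>: "\<gamma> \<in> C1_paths atlM J" and \<delta>: "horizontal_lift atlE \<pi> \<Delta> J \<gamma> \<delta>" and st: "s \<in> J" "t \<in> J"
  shows "transport_along \<pi> lift_transport \<gamma> s t (\<delta> s) = \<delta> t"
proof -
  have sub: "{x..y} \<subseteq> J" if "x \<in> J" "y \<in> J" for x y
    using C1_pathsD(2)[OF \<gamma>] that by (meson atLeastAtMost_iff mem_is_interval_1_I subsetI)
  have R: "restrict \<gamma> {x..y} \<in> C1_paths atlM {x..y}"
    "horizontal_lift atlE \<pi> \<Delta> {x..y} (restrict \<gamma> {x..y}) (restrict \<delta> {x..y})"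
    if "x \<in> J" "y \<in> J" "x \<le> y" for x y
    using C1_paths_restrict[OF \<gamma> _ _ sub[OF that(1,2)]] horizontal_lift_restrict[OF \<delta> _ _ sub[OF that(1,2)]] that(3)
    by (auto simp: is_interval_cc)
  show ?thesis
  proof (cases "s \<le> t")
    case True
    then show ?thesis
      using assigned_transport_eq[OF R[OF st True]] by (simp add: transport_along_def)
  next
    case False
    then have "t \<le> s" by simp
    from assigned_transport_inv_into[OF R[OF st(2,1) this]] show ?thesis
      using False horizontal_liftD(2)[OF \<delta> st(1)] by (simp add: transport_along_def)
  qed
qed

lemma generated_connection_assigned: "generated_connection atlM atlE \<pi> lift_transport = \<Delta>"
proof
  fix p
  have along: "(\<lambda>t\<in>J. transport_along \<pi> lift_transport \<gamma> s0 t (\<delta> s0)) = \<delta>"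
    if "\<gamma> \<in> C1_paths atlM J" "s0 \<in> J" "horizontal_lift atlE \<pi> \<Delta> J \<gamma> \<delta>" for J \<gamma> s0 \<delta>
    by (rule extensionalityI[OF restrict_extensional C1_pathsD(1)[OF horizontal_liftD(1)[OF that(3)]]])
      (simp add: transport_along_assigned[OF that(1,3,2)])
  show "generated_connection atlM atlE \<pi> lift_transport p = \<Delta> p"
  proof
    show "generated_connection atlM atlE \<pi> lift_transport p \<subseteq> \<Delta> p"
    proof
      fix v assume "v \<in> generated_connection atlM atlE \<pi> lift_transport p"
      then obtain J \<gamma> s0 where v: "v = velocity atlE J (\<lambda>t\<in>J. transport_along \<pi> lift_transport \<gamma> s0 t p) s0"
        and \<gamma>: "\<gamma> \<in> C1_paths atlM J" and s0: "s0 \<in> J" "J \<noteq> {s0}" "\<gamma> s0 = \<pi> p"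
        unfolding generated_connection_def by blast
      obtain \<delta> where \<delta>: "horizontal_lift atlE \<pi> \<Delta> J \<gamma> \<delta>" "\<delta> s0 = p"
        using horizontal_lift_exists[OF \<gamma> s0(1) s0(3)[symmetric]] by blast
      then show "v \<in> \<Delta> p"
        using v along[OF \<gamma> s0(1) \<delta>(1)] horizontal_liftD(3)[OF \<delta>(1) s0(1,2)] by simp
    qed
    show "\<Delta> p \<subseteq> generated_connection atlM atlE \<pi> lift_transport p"
    proof
      fix w assume w: "w \<in> \<Delta> p"
      obtain c c' where c: "c \<in> atlE" "c' \<in> atlM" "p \<in> fst c" "\<pi> p \<in> fst c'"
        using C1_manifold_cover[OF manifold_base] C1_manifold_cover[OF manifold_total] by metis
      \<comment> \<open>An injective path with the projection of \<open>w\<close> as its velocity;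
        the lift of this path through \<open>p\<close> then has velocity \<open>w\<close>, both
        being horizontal with the same projection.\<close>
      obtain \<epsilon> \<beta> where \<beta>: "\<epsilon> > 0" "\<beta> \<in> C1_paths atlM {0..\<epsilon>}" "\<beta> 0 = \<pi> p" "inj_on \<beta> {0..\<epsilon>}"
        "velocity atlM {0..\<epsilon>} \<beta> 0 c' = dproj c c' p w"
        using injective_curve[OF manifold_base c(2,4)] by metis
      obtain \<delta> where \<delta>: "horizontal_lift atlE \<pi> \<Delta> {0..\<epsilon>} \<beta> \<delta>" "\<delta> 0 = p"
        using horizontal_lift_from[OF \<beta>(2), of p] \<beta>(3) by auto
      have "velocity atlE {0..\<epsilon>} \<delta> 0 = w"
        by (rule horizontal_velocity_eqI[OF \<delta>(1)]) (use \<beta> c w \<delta>(2) in auto)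
      moreover have "(\<lambda>t\<in>{0..\<epsilon>}. transport_along \<pi> lift_transport \<beta> 0 t p) = \<delta>"
        using along[OF \<beta>(2) _ \<delta>(1), of 0] \<beta>(1) \<delta>(2) by simp
      ultimately have "w = velocity atlE {0..\<epsilon>} (\<lambda>t\<in>{0..\<epsilon>}. transport_along \<pi> lift_transport \<beta> 0 t p) 0"
        by simp
      moreover have "0 \<in> {0..\<epsilon>}" "{0..\<epsilon>} \<noteq> {0}"
        using \<beta>(1) by auto
      ultimately show "w \<in> generated_connection atlM atlE \<pi> lift_transport p"
        unfolding generated_connection_def using \<beta>(2-4) by blast
    qed
  qed
qed

end

section \<open>Axiomatic parallel transports\<close>

lemma C1_paths_reparam:
  assumes \<gamma>: "\<gamma> \<in> C1_paths A {\<sigma>..\<tau>}" and \<theta>: "orientation_preserving_C1_diffeo {\<sigma>'..\<tau>'} {\<sigma>..\<tau>} \<theta>"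
  shows "compose {\<sigma>'..\<tau>'} \<gamma> \<theta> \<in> C1_paths A {\<sigma>'..\<tau>'}"
proof -
  have "\<sigma> \<le> \<tau>"
    using C1_pathsD(3)[OF \<gamma>] by simp
  note ends = orientation_preserving_C1_diffeo_endpoints[OF \<theta> this]
  show ?thesis
    by (rule C1_paths_compose[OF \<gamma>])
      (use \<theta> ends(1,4) in \<open>auto simp: orientation_preserving_C1_diffeo_def is_interval_cc\<close>)
qed

locale axiomatic_transport =
  fixes atlM :: "('m::t2_space, 'k::{real_normed_field,euclidean_space}, 'n::finite) chart set"
    and atlE :: "('e::t2_space, 'k, 'd::finite) chart set"
    and \<pi> :: "'e \<Rightarrow> 'm" and P :: "('m, 'e) transport"
  assumes parallel_transport: "parallel_transport atlM atlE \<pi> P"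
begin

lemma P_maps: "\<gamma> \<in> C1_paths atlM {\<sigma>..\<tau>} \<Longrightarrow> P \<sigma> \<tau> \<gamma> \<in> fibre \<pi> (\<gamma> \<sigma>) \<rightarrow>\<^sub>E fibre \<pi> (\<gamma> \<tau>)"
  and P_undefined: "\<gamma> \<notin> C1_paths atlM {\<sigma>..\<tau>} \<Longrightarrow> P \<sigma> \<tau> \<gamma> = undefined"
  using parallel_transport[unfolded parallel_transport_def, THEN conjunct1]
  by (auto simp only: transport_maps_def if_True if_False split: if_splits)

lemma P_reparam:
  "\<gamma> \<in> C1_paths atlM {\<sigma>..\<tau>} \<Longrightarrow> orientation_preserving_C1_diffeo {\<sigma>'..\<tau>'} {\<sigma>..\<tau>} \<theta> \<Longrightarrow>
    P \<sigma>' \<tau>' (compose {\<sigma>'..\<tau>'} \<gamma> \<theta>) = P \<sigma> \<tau> \<gamma>"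
  using parallel_transport[unfolded parallel_transport_def, THEN conjunct2, THEN conjunct1] by blast

lemma P_bij: "\<gamma> \<in> C1_paths atlM {0..1} \<Longrightarrow> bij_betw (P 0 1 \<gamma>) (fibre \<pi> (\<gamma> 0)) (fibre \<pi> (\<gamma> 1))"
  and P_inverse_path: "\<gamma> \<in> C1_paths atlM {0..1} \<Longrightarrow>
    P 0 1 (inverse_path \<gamma>) = restrict (inv_into (fibre \<pi> (\<gamma> 0)) (P 0 1 \<gamma>)) (fibre \<pi> (\<gamma> 1))"
  using parallel_transport[unfolded parallel_transport_def, THEN conjunct2, THEN conjunct2, THEN conjunct1]
  by blast+

lemma P_product_path:
  "\<gamma>1 \<in> C1_paths atlM {0..1} \<Longrightarrow> \<gamma>2 \<in> C1_paths atlM {0..1} \<Longrightarrow> \<gamma>1 1 = \<gamma>2 0 \<Longrightarrow>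
    product_path \<gamma>1 \<gamma>2 \<in> C1_paths atlM {0..1} \<Longrightarrow>
    P 0 1 (product_path \<gamma>1 \<gamma>2) = compose (fibre \<pi> (\<gamma>1 0)) (P 0 1 \<gamma>2) (P 0 1 \<gamma>1)"
  using parallel_transport[unfolded parallel_transport_def, THEN conjunct2, THEN conjunct2, THEN conjunct2,
    THEN conjunct1] by blast

lemma P_const: "P r r (\<lambda>t\<in>{r..r}. x) = (\<lambda>p\<in>fibre \<pi> x. p)"
  using parallel_transport[unfolded parallel_transport_def, THEN conjunct2, THEN conjunct2, THEN conjunct2,
    THEN conjunct2, THEN conjunct1] by blast

lemma lifted_path_C1:
  "\<gamma> \<in> C1_paths atlM {\<sigma>..\<tau>} \<Longrightarrow> p \<in> fibre \<pi> (\<gamma> \<sigma>) \<Longrightarrow> lifted_path P \<sigma> \<tau> \<gamma> p \<in> C1_paths atlE {\<sigma>..\<tau>}"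
  using parallel_transport[unfolded parallel_transport_def, THEN conjunct2, THEN conjunct2, THEN conjunct2,
    THEN conjunct2, THEN conjunct2, THEN conjunct1] by blast

lemma lifted_path_velocity_eq:
  "\<gamma>1 \<in> C1_paths atlM {\<sigma>1..\<tau>1} \<Longrightarrow> \<gamma>2 \<in> C1_paths atlM {\<sigma>2..\<tau>2} \<Longrightarrow> \<sigma>1 < \<tau>1 \<Longrightarrow> \<sigma>2 < \<tau>2 \<Longrightarrow>
    \<gamma>1 \<sigma>1 = \<gamma>2 \<sigma>2 \<Longrightarrow> velocity atlM {\<sigma>1..\<tau>1} \<gamma>1 \<sigma>1 = velocity atlM {\<sigma>2..\<tau>2} \<gamma>2 \<sigma>2 \<Longrightarrow>
    p \<in> fibre \<pi> (\<gamma>1 \<sigma>1) \<Longrightarrow>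
    velocity atlE {\<sigma>1..\<tau>1} (lifted_path P \<sigma>1 \<tau>1 \<gamma>1 p) \<sigma>1 =
      velocity atlE {\<sigma>2..\<tau>2} (lifted_path P \<sigma>2 \<tau>2 \<gamma>2 p) \<sigma>2"
  using parallel_transport[unfolded parallel_transport_def, THEN conjunct2, THEN conjunct2, THEN conjunct2,
    THEN conjunct2, THEN conjunct2, THEN conjunct2, THEN conjunct1] by blast

section \<open>Splitting and reversing paths under the axioms\<close>

lemma P_in_fibre: "\<gamma> \<in> C1_paths atlM {\<sigma>..\<tau>} \<Longrightarrow> p \<in> fibre \<pi> (\<gamma> \<sigma>) \<Longrightarrow> P \<sigma> \<tau> \<gamma> p \<in> fibre \<pi> (\<gamma> \<tau>)"
  using P_maps by (rule PiE_mem)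

lemma P_trivial:
  assumes "\<gamma> \<in> C1_paths atlM {r..r}" "p \<in> fibre \<pi> (\<gamma> r)"
  shows "P r r \<gamma> p = p"
proof -
  have "\<gamma> = (\<lambda>t\<in>{r..r}. \<gamma> r)"
    by (rule extensionalityI[OF C1_pathsD(1)[OF assms(1)] restrict_extensional]) simp
  then have "P r r \<gamma> = (\<lambda>p\<in>fibre \<pi> (\<gamma> r). p)"
    using P_const[of r "\<gamma> r"] by simp
  then show ?thesis
    using assms(2) by simp
qed

text \<open>The product of \<open>\<gamma>\<close> up to \<open>s\<close> and \<open>\<gamma>\<close> from \<open>s\<close> is of class C1 if the two factors are parametrised
  by the two halves of one diffeomorphism of \<open>{0..1}\<close> onto \<open>{\<sigma>..\<tau>}\<close> taking \<open>1/2\<close> to \<open>s\<close>; there is a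
  fractional linear one.\<close>

lemma P_split:
  assumes \<gamma>: "\<gamma> \<in> C1_paths atlM {\<sigma>..\<tau>}" and s: "s \<in> {\<sigma>..\<tau>}" and p: "p \<in> fibre \<pi> (\<gamma> \<sigma>)"
  shows "P \<sigma> \<tau> \<gamma> p = P s \<tau> (restrict \<gamma> {s..\<tau>}) (P \<sigma> s (restrict \<gamma> {\<sigma>..s}) p)"
proof -
  have R: "restrict \<gamma> {x..y} \<in> C1_paths atlM {x..y}" if "\<sigma> \<le> x" "x \<le> y" "y \<le> \<tau>" for x y
    using C1_paths_restrict[OF \<gamma>, of "{x..y}"] that by (auto simp: is_interval_cc)
  have whole: "restrict \<gamma> {\<sigma>..\<tau>} = \<gamma>"
    using C1_pathsD(1)[OF \<gamma>] by (rule extensional_restrict)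
  \<comment> \<open>At an end of the interval one of the two pieces is a single point and has no
    diffeomorphism onto the unit interval; constant transport handles it.\<close>
  consider "s = \<sigma>" | "s = \<tau>" | "\<sigma> < s" "s < \<tau>"
    using s by fastforce
  then show ?thesis
  proof cases
    case 1
    then show ?thesis
      using P_trivial[OF R[of \<sigma> \<sigma>], of p] s p whole by simp
  next
    case 2
    have "P \<sigma> \<tau> \<gamma> p \<in> fibre \<pi> (\<gamma> \<tau>)"
      by (rule P_in_fibre[OF \<gamma> p])
    then show ?thesis
      using P_trivial[OF R[of \<tau> \<tau>], of "P \<sigma> \<tau> \<gamma> p"] s 2 whole by simp
  next
    case 3
    \<comment> \<open>The point \<open>s\<close> is the mean of \<open>\<sigma>\<close> and
      \<open>\<tau>\<close> with weights \<open>\<tau> - s\<close> and \<open>s - \<sigma>\<close>.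
      Taking these weights as the denominators at 0 and at 1 makes the values there
      \<open>\<sigma>\<close> and \<open>\<tau>\<close>, and the value at 1/2 is their weighted mean
      \<open>s\<close>.\<close>
    define a b c d where "a = \<tau> * (s - \<sigma>) - \<sigma> * (\<tau> - s)" and "b = \<sigma> * (\<tau> - s)"
      and "c = (s - \<sigma>) - (\<tau> - s)" and "d = \<tau> - s"
    define m where "m = (\<lambda>x. (a * x + b) / (c * x + d))"
    \<comment> \<open>\<open>m1\<close> and \<open>m2\<close> are \<open>m\<close> after
      \<open>x / 2\<close> and after \<open>(x + 1) / 2\<close>, written as fractional linear maps.
      Each has half the determinant of \<open>m\<close>.\<close>
    define m1 where "m1 = (\<lambda>x. (a/2 * x + b) / (c/2 * x + d))"
    define m2 where "m2 = (\<lambda>x. (a/2 * x + (a/2 + b)) / (c/2 * x + (c/2 + d)))"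
    have "a * d - b * c = (s - \<sigma>) * (\<tau> - s) * (\<tau> - \<sigma>)"
      by (simp add: a_def b_def c_def d_def algebra_simps)
    then have det: "a * d - b * c > 0"
      using 3 by simp
    have den: "d > 0" "c + d > 0"
      using 3 by (auto simp: c_def d_def)
    then have den_mid: "c/2 + d > 0"
      by linarith
    have vals: "m 0 = \<sigma>" "m 1 = \<tau>" "m (1/2) = s"
    proof -
      have "a + b = \<tau> * (c + d)" "b = \<sigma> * d" "a * (1/2) + b = s * (c * (1/2) + d)"
        by (auto simp: a_def b_def c_def d_def field_simps)
      then show "m 0 = \<sigma>" "m 1 = \<tau>" "m (1/2) = s"
        using den den_mid by (auto simp: m_def)
    qed
    have m1: "m1 x = m (x / 2)" and m2: "m2 x = m ((x + 1) / 2)" for x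
      by (auto simp: m_def m1_def m2_def field_simps)
    have D: "orientation_preserving_C1_diffeo {0..1} {\<sigma>..\<tau>} m"
      using moebius_diffeo[of a d b c 0 1] det den vals by (simp add: m_def)
    have "orientation_preserving_C1_diffeo {0..1} {m1 0..m1 1} m1"
      unfolding m1_def by (rule moebius_diffeo) (use det den den_mid in auto)
    then have D1: "orientation_preserving_C1_diffeo {0..1} {\<sigma>..s} m1"
      using m1 vals by simp
    have "orientation_preserving_C1_diffeo {0..1} {m2 0..m2 1} m2"
      unfolding m2_def by (rule moebius_diffeo) (use det den den_mid in \<open>auto simp: algebra_simps\<close>)
    then have D2: "orientation_preserving_C1_diffeo {0..1} {s..\<tau>} m2"
      using m2 vals by simp
    define g1 g2 where "g1 = compose {0..1} (restrict \<gamma> {\<sigma>..s}) m1"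
      and "g2 = compose {0..1} (restrict \<gamma> {s..\<tau>}) m2"
    have R1: "restrict \<gamma> {\<sigma>..s} \<in> C1_paths atlM {\<sigma>..s}" and R2: "restrict \<gamma> {s..\<tau>} \<in> C1_paths atlM {s..\<tau>}"
      using R 3 by auto
    have g: "g1 \<in> C1_paths atlM {0..1}" "g2 \<in> C1_paths atlM {0..1}"
      unfolding g1_def g2_def using C1_paths_reparam[OF R1 D1] C1_paths_reparam[OF R2 D2] by auto
    have im1: "m1 x \<in> {\<sigma>..s}" and im2: "m2 x \<in> {s..\<tau>}" if "x \<in> {0..1}" for x
      using orientation_preserving_C1_diffeo_endpoints(4)[OF D1]
        orientation_preserving_C1_diffeo_endpoints(4)[OF D2] 3 that by auto
    have "g1 x = \<gamma> (m1 x)" "g2 x = \<gamma> (m2 x)" if "x \<in> {0..1}" for x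
      using that im1[OF that] im2[OF that] by (simp_all add: g1_def g2_def compose_eq)
    then have g_val: "g1 x = \<gamma> (m (x / 2))" "g2 x = \<gamma> (m ((x + 1) / 2))" if "x \<in> {0..1}" for x
      using that unfolding m1 m2 by blast+
    have prod: "product_path g1 g2 = compose {0..1} \<gamma> m"
    proof (rule extensionalityI)
      show "product_path g1 g2 \<in> extensional {0..1}"
        by (simp add: product_path_def)
      fix x :: real assume x: "x \<in> {0..1}"
      show "product_path g1 g2 x = compose {0..1} \<gamma> m x"
      proof (cases "x \<le> 1/2")
        case True
        then show ?thesis
          using x g_val(1)[of "2 * x"] by (simp add: product_path_def compose_eq)
      next
        case False
        then show ?thesis
          using x g_val(2)[of "2 * x - 1"] by (simp add: product_path_def compose_eq)
      qed
    qed (rule compose_extensional)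
    have "P \<sigma> \<tau> \<gamma> = P 0 1 (product_path g1 g2)"
      unfolding prod by (rule P_reparam[OF \<gamma> D, symmetric])
    also have "\<dots> = compose (fibre \<pi> (g1 0)) (P 0 1 g2) (P 0 1 g1)"
    proof (rule P_product_path[OF g])
      show "g1 1 = g2 0"
        using g_val(1)[of 1] g_val(2)[of 0] by simp
      show "product_path g1 g2 \<in> C1_paths atlM {0..1}"
        unfolding prod by (rule C1_paths_reparam[OF \<gamma> D])
    qed
    also have "P 0 1 g1 = P \<sigma> s (restrict \<gamma> {\<sigma>..s})"
      unfolding g1_def by (rule P_reparam[OF R1 D1])
    also have "P 0 1 g2 = P s \<tau> (restrict \<gamma> {s..\<tau>})"
      unfolding g2_def by (rule P_reparam[OF R2 D2])
    also have "g1 0 = \<gamma> \<sigma>"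
      using g_val(1)[of 0] vals by simp
    finally show ?thesis
      by (simp only: compose_eq[OF p])
  qed
qed

lemma C1_paths_reverse:
  assumes "\<gamma> \<in> C1_paths A J" "0 \<le> l" "{s - l..s} \<subseteq> J"
  shows "compose {0..l} \<gamma> (\<lambda>t. s - t) \<in> C1_paths A {0..l}"
  by (rule C1_paths_compose[OF assms(1)])
    (use assms(2,3) C1_on_affine[of "{0..l}" "- 1" s] in \<open>auto simp: is_interval_cc\<close>)

text \<open>The axiom on inverses concerns the unit interval. Affine reparametrisations carry
  \<open>\<gamma>\<close> and its reversal there, where the reversal becomes
  \<open>inverse_path\<close>, and the bijectivity in the same axiom lets the inverse cancel
  \<open>P a b \<gamma>\<close>.\<close>

lemma P_reverse:
  assumes \<gamma>: "\<gamma> \<in> C1_paths atlM {a..b}" and q: "q \<in> fibre \<pi> (\<gamma> a)"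
  shows "P 0 (b - a) (compose {0..b - a} \<gamma> (\<lambda>t. b - t)) (P a b \<gamma> q) = q"
proof -
  have "a \<le> b"
    using C1_pathsD(3)[OF \<gamma>] by simp
  have \<rho>: "compose {0..b - a} \<gamma> (\<lambda>t. b - t) \<in> C1_paths atlM {0..b - a}" (is "?\<rho> \<in> _")
    by (rule C1_paths_reverse[OF \<gamma>]) (use \<open>a \<le> b\<close> in auto)
  show ?thesis
  \<comment> \<open>A one-point interval is not the affine image of the unit interval by an
    increasing map, so it is treated by constant transport.\<close>
  proof (cases "a = b")
    case True
    have "P a b \<gamma> q = q"
      using P_trivial[of \<gamma> b q] \<gamma> q True by simp
    moreover have "P 0 0 ?\<rho> q = q"
      using P_trivial[of ?\<rho> 0 q] \<rho> q True by (simp add: compose_eq)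
    ultimately show ?thesis
      using True by simp
  next
    case False
    then have "b - a > 0"
      using \<open>a \<le> b\<close> by simp
    from affine_diffeo[OF this, of 0 1 a] affine_diffeo[OF this, of 0 1 0]
    have D: "orientation_preserving_C1_diffeo {0..1} {a..b} (\<lambda>x. (b - a) * x + a)"
      and D': "orientation_preserving_C1_diffeo {0..1} {0..b - a} (\<lambda>x. (b - a) * x + 0)"
      by (simp_all add: algebra_simps)
    let ?g = "compose {0..1} \<gamma> (\<lambda>x. (b - a) * x + a)"
    have g: "?g \<in> C1_paths atlM {0..1}"
      by (rule C1_paths_reparam[OF \<gamma> D])
    have ends: "?g 0 = \<gamma> a" "?g 1 = \<gamma> b"
      by (simp_all add: compose_eq)
    have inv: "inverse_path ?g = compose {0..1} ?\<rho> (\<lambda>x. (b - a) * x + 0)"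
    proof (rule extensionalityI)
      fix x :: real assume x: "x \<in> {0..1}"
      then have "(b - a) * x \<in> {0..b - a}"
        using \<open>b - a > 0\<close> by (auto simp: mult_left_le)
      moreover have "(b - a) * (1 - x) + a = b - (b - a) * x"
        by (simp add: algebra_simps)
      ultimately show "inverse_path ?g x = compose {0..1} ?\<rho> (\<lambda>x. (b - a) * x + 0) x"
        using x by (simp add: inverse_path_def compose_eq)
    qed (simp_all add: inverse_path_def compose_extensional)
    have "P 0 (b - a) ?\<rho> = P 0 1 (inverse_path ?g)"
      unfolding inv by (rule P_reparam[OF \<rho> D', symmetric])
    also have "\<dots> = restrict (inv_into (fibre \<pi> (\<gamma> a)) (P a b \<gamma>)) (fibre \<pi> (\<gamma> b))"
      using P_inverse_path[OF g] unfolding ends P_reparam[OF \<gamma> D] .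
    finally have "P 0 (b - a) ?\<rho> (P a b \<gamma> q) = inv_into (fibre \<pi> (\<gamma> a)) (P a b \<gamma>) (P a b \<gamma> q)"
      using P_in_fibre[OF \<gamma> q] by simp
    also have "inj_on (P a b \<gamma>) (fibre \<pi> (\<gamma> a))"
      using bij_betw_imp_inj_on[OF P_bij[OF g]] unfolding ends P_reparam[OF \<gamma> D] .
    then have "inv_into (fibre \<pi> (\<gamma> a)) (P a b \<gamma>) (P a b \<gamma> q) = q"
      using q by (rule inv_into_f_f)
    finally show ?thesis .
  qed
qed

lemma lifted_path_start:
  assumes "\<gamma> \<in> C1_paths atlM {\<sigma>..\<tau>}" "p \<in> fibre \<pi> (\<gamma> \<sigma>)"
  shows "lifted_path P \<sigma> \<tau> \<gamma> p \<sigma> = p"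
proof -
  have "\<sigma> \<le> \<tau>"
    using C1_pathsD(3)[OF assms(1)] by simp
  then show ?thesis
    using P_trivial[OF C1_paths_restrict[OF assms(1), of "{\<sigma>..\<sigma>}"], of p] assms(2) is_interval_cc[of \<sigma> \<sigma>]
    by (simp add: lifted_path_def)
qed

lemma lifted_path_in_fibre:
  assumes \<gamma>: "\<gamma> \<in> C1_paths atlM {\<sigma>..\<tau>}" and p: "p \<in> fibre \<pi> (\<gamma> \<sigma>)" and s: "s \<in> {\<sigma>..\<tau>}"
  shows "lifted_path P \<sigma> \<tau> \<gamma> p s \<in> fibre \<pi> (\<gamma> s)"
  using P_in_fibre[OF C1_paths_restrict[OF \<gamma>, of "{\<sigma>..s}"], of p] p s
  by (simp add: lifted_path_def is_interval_cc)

text \<open>Splitting at \<open>s - t\<close> shows that \<open>\<delta> s\<close> arises from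
  \<open>\<delta> (s - t)\<close> by transport along the last piece of \<open>\<gamma>\<close>;
  transport along the reversed piece undoes this. Thus a lift traversed backwards is itself a lifted
  path, starting at \<open>\<delta> s\<close>.\<close>

lemma lifted_path_reverse:
  assumes \<gamma>: "\<gamma> \<in> C1_paths atlM {\<sigma>..\<tau>}" and p: "p \<in> fibre \<pi> (\<gamma> \<sigma>)" and s: "s \<in> {\<sigma>..\<tau>}"
  defines "\<delta> \<equiv> lifted_path P \<sigma> \<tau> \<gamma> p"
  shows "lifted_path P 0 (s - \<sigma>) (compose {0..s - \<sigma>} \<gamma> (\<lambda>t. s - t)) (\<delta> s) =
    compose {0..s - \<sigma>} \<delta> (\<lambda>t. s - t)"
proof (rule extensionalityI[OF _ compose_extensional])
  show "lifted_path P 0 (s - \<sigma>) (compose {0..s - \<sigma>} \<gamma> (\<lambda>t. s - t)) (\<delta> s) \<in> extensional {0..s - \<sigma>}"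
    by (simp add: lifted_path_def)
  fix t assume t: "t \<in> {0..s - \<sigma>}"
  have R: "restrict \<gamma> {x..y} \<in> C1_paths atlM {x..y}" if "\<sigma> \<le> x" "x \<le> y" "y \<le> \<tau>" for x y
    using C1_paths_restrict[OF \<gamma>, of "{x..y}"] that by (auto simp: is_interval_cc)
  \<comment> \<open>The interval is written as \<open>{0..s - (s - t)}\<close> to match the shape of
    \<open>P_reverse\<close> for the piece of \<open>\<gamma>\<close> over
    \<open>{s - t..s}\<close>.\<close>
  have rho: "restrict (compose {0..s - \<sigma>} \<gamma> (\<lambda>u. s - u)) {0..t} =
      compose {0..s - (s - t)} (restrict \<gamma> {s - t..s}) (\<lambda>u. s - u)"
    by (rule extensionalityI[of _ "{0..t}"]) (use t in \<open>auto simp: compose_def\<close>)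
  have start: "\<delta> (s - t) \<in> fibre \<pi> (\<gamma> (s - t))"
    unfolding \<delta>_def by (rule lifted_path_in_fibre[OF \<gamma> p]) (use s t in auto)
  have "\<delta> s = P (s - t) s (restrict \<gamma> {s - t..s}) (\<delta> (s - t))"
  proof -
    have "P \<sigma> s (restrict \<gamma> {\<sigma>..s}) p =
      P (s - t) s (restrict (restrict \<gamma> {\<sigma>..s}) {s - t..s}) (P \<sigma> (s - t) (restrict (restrict \<gamma> {\<sigma>..s}) {\<sigma>..s - t}) p)"
      by (rule P_split[OF R]) (use s t p in auto)
    moreover have "{\<sigma>..s} \<inter> {s - t..s} = {s - t..s}" "{\<sigma>..s} \<inter> {\<sigma>..s - t} = {\<sigma>..s - t}"
      using t by auto
    ultimately show ?thesis
      using s t by (simp add: \<delta>_def lifted_path_def)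
  qed
  then have "P 0 t (restrict (compose {0..s - \<sigma>} \<gamma> (\<lambda>u. s - u)) {0..t}) (\<delta> s) = \<delta> (s - t)"
    using P_reverse[OF R[of "s - t" s], of "\<delta> (s - t)"] start s t unfolding rho by simp
  then show "lifted_path P 0 (s - \<sigma>) (compose {0..s - \<sigma>} \<gamma> (\<lambda>t. s - t)) (\<delta> s) t =
      compose {0..s - \<sigma>} \<delta> (\<lambda>t. s - t) t"
    using t by (simp add: lifted_path_def compose_eq)
qed

text \<open>The path \<open>\<gamma>\<close> need not be injective, but some injective path has the same initial velocity.\<close>

lemma lifted_path_velocity_generated:
  assumes M: "C1_manifold atlM" and \<gamma>: "\<gamma> \<in> C1_paths atlM {\<sigma>..\<tau>}" and lt: "\<sigma> < \<tau>" and p: "p \<in> fibre \<pi> (\<gamma> \<sigma>)"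
  shows "velocity atlE {\<sigma>..\<tau>} (lifted_path P \<sigma> \<tau> \<gamma> p) \<sigma> \<in> generated_connection atlM atlE \<pi> P p"
proof -
  obtain c where c: "c \<in> atlM" "\<gamma> \<sigma> \<in> fst c"
    using C1_manifold_cover[OF M] by metis
  obtain \<epsilon> \<beta> where \<beta>: "\<epsilon> > 0" "\<beta> \<in> C1_paths atlM {0..\<epsilon>}" "\<beta> 0 = \<gamma> \<sigma>" "inj_on \<beta> {0..\<epsilon>}"
    "velocity atlM {0..\<epsilon>} \<beta> 0 c = velocity atlM {\<sigma>..\<tau>} \<gamma> \<sigma> c"
    using injective_curve[OF M c] by metis
  have "0 \<in> {0..\<epsilon>}" "{0..\<epsilon>} \<noteq> {0}" "\<sigma> \<in> {\<sigma>..\<tau>}" "{\<sigma>..\<tau>} \<noteq> {\<sigma>}"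
    using \<beta>(1) lt by auto
  then have "velocity atlM {0..\<epsilon>} \<beta> 0 \<in> tangent_space atlM (\<gamma> \<sigma>)"
    "velocity atlM {\<sigma>..\<tau>} \<gamma> \<sigma> \<in> tangent_space atlM (\<gamma> \<sigma>)"
    using velocity_in_tangent_space[OF M \<beta>(2)] velocity_in_tangent_space[OF M \<gamma>] \<beta>(3) by metis+
  \<comment> \<open>The curve was matched to \<open>\<gamma>\<close> in one chart only; both
    velocities being tangent vectors at the same point, they agree in all charts.\<close>
  then have "velocity atlM {\<sigma>..\<tau>} \<gamma> \<sigma> = velocity atlM {0..\<epsilon>} \<beta> 0"
    using tangent_space_eqI c \<beta>(5) by metis
  then have "velocity atlE {\<sigma>..\<tau>} (lifted_path P \<sigma> \<tau> \<gamma> p) \<sigma> = velocity atlE {0..\<epsilon>} (lifted_path P 0 \<epsilon> \<beta> p) 0"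
    by (rule lifted_path_velocity_eq[OF \<gamma> \<beta>(2) lt \<beta>(1) \<beta>(3)[symmetric] _ p])
  \<comment> \<open>All times are at least 0, so \<open>transport_along\<close> takes its first
    branch throughout.\<close>
  also have "lifted_path P 0 \<epsilon> \<beta> p = (\<lambda>t\<in>{0..\<epsilon>}. transport_along \<pi> P \<beta> 0 t p)"
    by (auto simp: lifted_path_def transport_along_def fun_eq_iff)
  finally have "velocity atlE {\<sigma>..\<tau>} (lifted_path P \<sigma> \<tau> \<gamma> p) \<sigma> =
      velocity atlE {0..\<epsilon>} (\<lambda>t\<in>{0..\<epsilon>}. transport_along \<pi> P \<beta> 0 t p) 0" .
  moreover have "\<beta> 0 = \<pi> p"
    using \<beta>(3) p by simp
  ultimately show ?thesis
    unfolding generated_connection_def mem_Collect_eq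
    using \<beta>(2,4) \<open>0 \<in> {0..\<epsilon>}\<close> \<open>{0..\<epsilon>} \<noteq> {0}\<close>
    by (intro exI[of _ "{0..\<epsilon>}"] exI[of _ \<beta>] exI[of _ 0] conjI)
qed

end

section \<open>Uniqueness of the transport\<close>

context bundle_connection
begin

text \<open>The velocity of a lifted path at an interior or end time \<open>s\<close> is minus the initial velocity of the lifted
  path of \<open>\<gamma>\<close> traversed backwards from \<open>s\<close>.\<close>

lemma lifted_path_horizontal:
  assumes P: "parallel_transport atlM atlE \<pi> P" "generated_connection atlM atlE \<pi> P = \<Delta>"
    and \<gamma>: "\<gamma> \<in> C1_paths atlM {\<sigma>..\<tau>}" and p: "p \<in> fibre \<pi> (\<gamma> \<sigma>)"
  shows "horizontal_lift atlE \<pi> \<Delta> {\<sigma>..\<tau>} \<gamma> (lifted_path P \<sigma> \<tau> \<gamma> p)"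
proof -
  interpret axiomatic_transport atlM atlE \<pi> P
    by unfold_locales (rule P(1))
  define \<delta> where "\<delta> = lifted_path P \<sigma> \<tau> \<gamma> p"
  have \<delta>: "\<delta> \<in> C1_paths atlE {\<sigma>..\<tau>}"
    unfolding \<delta>_def by (rule lifted_path_C1[OF \<gamma> p])
  have proj: "\<delta> s \<in> fibre \<pi> (\<gamma> s)" if "s \<in> {\<sigma>..\<tau>}" for s
    unfolding \<delta>_def by (rule lifted_path_in_fibre[OF \<gamma> p that])
  note initial = lifted_path_velocity_generated[OF manifold_base, unfolded P(2)]
  have "velocity atlE {\<sigma>..\<tau>} \<delta> s \<in> \<Delta> (\<delta> s)" if s: "s \<in> {\<sigma>..\<tau>}" "{\<sigma>..\<tau>} \<noteq> {s}" for s
  proof (cases "s = \<sigma>")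
    case True
    then have "\<sigma> < \<tau>"
      using s by force
    then show ?thesis
      using initial[OF \<gamma> _ p] lifted_path_start[OF \<gamma> p] True by (simp add: \<delta>_def)
  next
    case False
    then have l: "0 < s - \<sigma>"
      using s by simp
    have sub: "{s - (s - \<sigma>)..s} \<subseteq> {\<sigma>..\<tau>}"
      using s by auto
    have \<rho>: "compose {0..s - \<sigma>} \<gamma> (\<lambda>t. s - t) \<in> C1_paths atlM {0..s - \<sigma>}"
      by (rule C1_paths_reverse[OF \<gamma> _ sub]) (use l in simp)
    have "velocity atlE {0..s - \<sigma>} (compose {0..s - \<sigma>} \<delta> (\<lambda>t. s - t)) 0 \<in> \<Delta> (\<delta> s)"
      unfolding \<delta>_def lifted_path_reverse[OF \<gamma> p s(1), symmetric]
      by (rule initial[OF \<rho> l]) (use lifted_path_in_fibre[OF \<gamma> p s(1)] l in \<open>simp add: compose_eq\<close>)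
    \<comment> \<open>The reversed path sees only times up to \<open>s\<close>, but
      \<open>\<delta>\<close> is already known to be differentiable within
      \<open>{\<sigma>..\<tau>}\<close>, so its left derivative at an interior time is its full
      velocity.\<close>
    also have "velocity atlE {0..s - \<sigma>} (compose {0..s - \<sigma>} \<delta> (\<lambda>t. s - t)) 0 =
        tscale (of_real (- 1)) (velocity atlE {\<sigma>..\<tau>} \<delta> (s - 0))"
      by (rule velocity_compose[OF manifold_total \<delta>])
        (use l s in \<open>auto simp: is_interval_cc intro!: derivative_eq_intros\<close>)
    finally have "tscale (- 1) (tscale (of_real (- 1)) (velocity atlE {\<sigma>..\<tau>} \<delta> (s - 0))) \<in> \<Delta> (\<delta> s)"
      by (rule tangent.subspace_scale[OF subspace_\<Delta>])
    then show ?thesis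
      by (simp add: tscale_def)
  qed
  then show ?thesis
    using \<delta> proj unfolding \<delta>_def horizontal_lift_def by blast
qed

text \<open>On C1 paths and fibre points, the lifted path of \<open>P\<close> is the horizontal lift
  that defines the assigned transport, and its end value is the value of \<open>P\<close>. Elsewhere
  both transports are \<open>undefined\<close> by their typing, which gives equality of total
  functions.\<close>

lemma parallel_transport_eq_assigned:
  assumes P: "parallel_transport atlM atlE \<pi> P" "generated_connection atlM atlE \<pi> P = \<Delta>"
  shows "P = lift_transport"
proof (intro ext)
  interpret axiomatic_transport atlM atlE \<pi> P
    by unfold_locales (rule P(1))
  fix \<sigma> \<tau> \<gamma> p
  show "P \<sigma> \<tau> \<gamma> p = lift_transport \<sigma> \<tau> \<gamma> p"
  proof (cases "\<gamma> \<in> C1_paths atlM {\<sigma>..\<tau>}")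
    case \<gamma>: True
    show ?thesis
    proof (cases "p \<in> fibre \<pi> (\<gamma> \<sigma>)")
      case p: True
      have "lift_transport \<sigma> \<tau> \<gamma> p = lifted_path P \<sigma> \<tau> \<gamma> p \<tau>"
        using assigned_transport_eq[OF \<gamma> lifted_path_horizontal[OF P \<gamma> p]] lifted_path_start[OF \<gamma> p]
        by simp
      also have "\<dots> = P \<sigma> \<tau> \<gamma> p"
        using C1_pathsD(3)[OF \<gamma>] extensional_restrict[OF C1_pathsD(1)[OF \<gamma>]]
        by (simp add: lifted_path_def)
      finally show ?thesis ..
    next
      case False
      then show ?thesis
        using PiE_arb[OF P_maps[OF \<gamma>]] extensional_arb[OF assigned_transport_extensional[OF \<gamma>]] by metis
    qed
  next
    case False
    then show ?thesis
      using P_undefined by (simp add: assigned_transport_def)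
  qed
qed

end

theorem theorem7p5:
  fixes atlM :: "('m::t2_space, 'k::{real_normed_field,euclidean_space}, 'n::finite) chart set"
    and atlE :: "('e::t2_space, 'k, 'n + 'r::finite) chart set"
    and \<pi> :: "'e \<Rightarrow> 'm"
    and \<Delta>h :: "'e \<Rightarrow> ('e, 'k, 'n + 'r) tvec set"
  assumes "C1_bundle atlM atlE \<pi>"
    and "connection atlM atlE \<pi> \<Delta>h"
  shows "(\<exists>!P. parallel_transport atlM atlE \<pi> P \<and> generated_connection atlM atlE \<pi> P = \<Delta>h) \<and>
         (\<forall>P. parallel_transport atlM atlE \<pi> P \<and> generated_connection atlM atlE \<pi> P = \<Delta>h \<longrightarrow>
              P = assigned_transport atlM atlE \<pi> \<Delta>h)"
proof -
  interpret bundle_connection atlM atlE \<pi> \<Delta>h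
    using assms by unfold_locales
  show ?thesis
    using parallel_transport_assigned generated_connection_assigned parallel_transport_eq_assigned by blast
qed

end
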